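(* Let $\omega=A_0\,dx_0+A_1\,dx_1+A_2\,dx_2\in\mathcal{F}^1(\mathbb{P}^2,e)$ and let $F=(F_0:F_1:F_2):\mathbb{P}^n\dashrightarrow\mathbb{P}^2$ be a dominant rational map given by homogeneous polynomials $F_i$ of the same degree $\nu$, such that $(F,\omega)$ is a generic pair. Then \[ I(F^*\omega)=K(F^*\omega)=\big(A_0(F),A_1(F),A_2(F)\big). \]
   Context: For $m\ge 2$, $S_m=\mathbb{C}[x_0,\ldots,x_m]$, $R=\sum x_i\partial/\partial x_i$, and $\mathcal{F}^1(\mathbb{P}^m,e)$ ($e\ge2$) is the set of (classes up to scalar of) $\omega=\sum B_i dx_i$, $B_i\in S_m$ homogeneous of degree $e-1$, not all zero, with $i_R\omega=0$, $\omega\wedge d\omega=0$ and zero locus $\mathrm{sing}(\omega)\subseteq\mathbb{P}^m$ of codimension $\ge2$. For such $\omega$: $\mathscr{C}(\eta)$ denotes the ideal of coefficients of a form $\eta$, $J(\omega)=\mathscr{C}(\omega)$, $I(\omega)=\{h: h\,d\omega=\omega\wedge\eta\text{ for some polynomial 1-form }\eta\}$, $K(\omega)=(J(\omega):\mathscr{C}(d\omega))$. The pullback $F^*\omega=\sum_i A_i(F)\,dF_i$ is an integrable 1-form on $\mathbb{C}^{n+1}$ descending to $\mathbb{P}^n$. $(F,\omega)$ is a generic pair if: $\mathrm{sing}(\omega)$ is reduced and consists only of Kupka points (points where $\omega=0$ and $d\omega\neq0$), the critical values of $F$ are disjoint from $\mathrm{sing}(\omega)$, and the set of critical points of $F$ is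 disjoint from $\{F_0=F_1=F_2=0\}$. *)

theory Defs
  imports "HOL-Analysis.Analysis"
begin

text \<open>Homogeneous coordinates of C^(N) are modelled by the type complex^'n (N = CARD('n)).
Polynomials are modelled as polynomial functions (over the infinite field C these are
the same as polynomials).\<close>

inductive polyfun :: "(complex^'n \<Rightarrow> complex) \<Rightarrow> bool" where
  pconst: "polyfun (\<lambda>x. c)"
| pvar: "polyfun (\<lambda>x. x $ i)"
| padd: "polyfun f \<Longrightarrow> polyfun g \<Longrightarrow> polyfun (\<lambda>x. f x + g x)"
| pmult: "polyfun f \<Longrightarrow> polyfun g \<Longrightarrow> polyfun (\<lambda>x. f x * g x)"

definition pd :: "'n \<Rightarrow> (complex^'n \<Rightarrow> complex) \<Rightarrow> complex^'n \<Rightarrow> complex" where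
  "pd j f x = deriv (\<lambda>t. f (x + t *s axis j 1)) 0"

definition homog :: "(complex^'n \<Rightarrow> complex) \<Rightarrow> nat \<Rightarrow> bool" where
  "homog f d \<longleftrightarrow> polyfun f \<and> (\<forall>t x. f (t *s x) = t ^ d * f x)"

definition gen_ideal :: "(complex^'n \<Rightarrow> complex) set \<Rightarrow> (complex^'n \<Rightarrow> complex) set" where
  "gen_ideal G = {h. \<exists>S c. finite S \<and> S \<subseteq> G \<and> (\<forall>g\<in>S. polyfun (c g)) \<and>
                         h = (\<lambda>x. \<Sum>g\<in>S. c g x * g x)}"

text \<open>A polynomial 1-form \<omega> = \<Sum> B_i dx_i is given by its coefficients B.
 2-forms are given by antisymmetric coefficient functions (i,j) (coefficient of dx_i \<and> dx_j).\<close>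
definition dform :: "('n \<Rightarrow> complex^'n \<Rightarrow> complex) \<Rightarrow> 'n \<Rightarrow> 'n \<Rightarrow> complex^'n \<Rightarrow> complex" where
  "dform B i j = (\<lambda>x. pd i (B j) x - pd j (B i) x)"

definition wedge11 :: "('n \<Rightarrow> complex^'n \<Rightarrow> complex) \<Rightarrow> ('n \<Rightarrow> complex^'n \<Rightarrow> complex)
    \<Rightarrow> 'n \<Rightarrow> 'n \<Rightarrow> complex^'n \<Rightarrow> complex" where
  "wedge11 B \<eta> i j = (\<lambda>x. B i x * \<eta> j x - B j x * \<eta> i x)"

text \<open>\<omega> \<and> d\<omega> = 0 (all coefficients of the 3-form vanish).\<close>
definition integrable :: "('n \<Rightarrow> complex^'n \<Rightarrow> complex) \<Rightarrow> bool" where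
  "integrable B \<longleftrightarrow> (\<forall>i j k. (\<lambda>x. B i x * dform B j k x - B j x * dform B i k x
                                       + B k x * dform B i j x) = (\<lambda>x. 0))"

definition Jid :: "('n \<Rightarrow> complex^'n \<Rightarrow> complex) \<Rightarrow> (complex^'n \<Rightarrow> complex) set" where
  "Jid B = gen_ideal (range B)"

definition Iid :: "('n \<Rightarrow> complex^'n \<Rightarrow> complex) \<Rightarrow> (complex^'n \<Rightarrow> complex) set" where
  "Iid B = {h. polyfun h \<and> (\<exists>\<eta>. (\<forall>i. polyfun (\<eta> i)) \<and>
                (\<forall>i j. (\<lambda>x. h x * dform B i j x) = wedge11 B \<eta> i j))}"

definition Kid :: "('n \<Rightarrow> complex^'n \<Rightarrow> complex) \<Rightarrow> (complex^'n \<Rightarrow> complex) set" where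
  "Kid B = {h. polyfun h \<and> (\<forall>g \<in> gen_ideal {dform B i j | i j. True}.
                               (\<lambda>x. h x * g x) \<in> Jid B)}"

text \<open>The singular set (affine cone, without the origin).\<close>
definition sing_pts :: "('n \<Rightarrow> complex^'n \<Rightarrow> complex) \<Rightarrow> (complex^'n) set" where
  "sing_pts B = {p. p \<noteq> 0 \<and> (\<forall>i. B i p = 0)}"

definition saturation :: "(complex^'n \<Rightarrow> complex) set \<Rightarrow> (complex^'n \<Rightarrow> complex) set" where
  "saturation J = {h. polyfun h \<and> (\<forall>i. \<exists>k. (\<lambda>x. (x $ i) ^ k * h x) \<in> J)}"

text \<open>The projective scheme defined by the homogeneous ideal J is reduced iff J^sat is radical.\<close>
definition reduced_scheme :: "(complex^'n \<Rightarrow> complex) set \<Rightarrow> bool" where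
  "reduced_scheme J \<longleftrightarrow> (\<forall>h. polyfun h \<longrightarrow> (\<exists>k. (\<lambda>x. h x ^ k) \<in> saturation J) \<longrightarrow> h \<in> saturation J)"

text \<open>\<omega> \<in> F^1(P^2, e): in P^2, codimension \<ge> 2 of sing(\<omega>) means it is a finite set of points.\<close>
definition foliation_P2 :: "nat \<Rightarrow> (3 \<Rightarrow> complex^3 \<Rightarrow> complex) \<Rightarrow> bool" where
  "foliation_P2 e A \<longleftrightarrow> e \<ge> 2 \<and> (\<forall>i. homog (A i) (e - 1)) \<and> (\<exists>i. A i \<noteq> (\<lambda>x. 0)) \<and>
     (\<forall>x. (\<Sum>i\<in>UNIV. x $ i * A i x) = 0) \<and> integrable A \<and>
     (\<exists>S. finite S \<and> (\<forall>p \<in> sing_pts A. \<exists>q\<in>S. \<exists>c. p = c *s q))"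

definition Fvec :: "(3 \<Rightarrow> complex^'n \<Rightarrow> complex) \<Rightarrow> complex^'n \<Rightarrow> complex^3" where
  "Fvec F x = (\<chi> k. F k x)"

definition pullback :: "(3 \<Rightarrow> complex^'n \<Rightarrow> complex) \<Rightarrow> (3 \<Rightarrow> complex^3 \<Rightarrow> complex)
    \<Rightarrow> 'n \<Rightarrow> complex^'n \<Rightarrow> complex" where
  "pullback F A j = (\<lambda>x. \<Sum>i\<in>UNIV. A i (Fvec F x) * pd j (F i) x)"

definition dominant :: "(3 \<Rightarrow> complex^'n \<Rightarrow> complex) \<Rightarrow> bool" where
  "dominant F \<longleftrightarrow> (\<forall>G :: complex^3 \<Rightarrow> complex. polyfun G \<and> (\<forall>x. G (Fvec F x) = 0) \<longrightarrow> G = (\<lambda>y. 0))"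

text \<open>x (nonzero, in C^{n+1}) is a critical point of F: dF_0, dF_1, dF_2 linearly dependent at x
  (equivalently the differential of F : P^n --> P^2 is not surjective; base points included).\<close>
definition critical_pt :: "(3 \<Rightarrow> complex^'n \<Rightarrow> complex) \<Rightarrow> complex^'n \<Rightarrow> bool" where
  "critical_pt F x \<longleftrightarrow> x \<noteq> 0 \<and>
     (\<exists>c :: complex^3. c \<noteq> 0 \<and> (\<forall>j. (\<Sum>i\<in>UNIV. c $ i * pd j (F i) x) = 0))"

definition kupka_pt :: "('n \<Rightarrow> complex^'n \<Rightarrow> complex) \<Rightarrow> complex^'n \<Rightarrow> bool" where
  "kupka_pt B p \<longleftrightarrow> p \<in> sing_pts B \<and> (\<exists>i j. dform B i j p \<noteq> 0)"

definition generic_pair :: "(3 \<Rightarrow> complex^'n \<Rightarrow> complex) \<Rightarrow> (3 \<Rightarrow> complex^3 \<Rightarrow> complex) \<Rightarrow> bool" where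
  "generic_pair F A \<longleftrightarrow>
     reduced_scheme (Jid A) \<and> (\<forall>p \<in> sing_pts A. kupka_pt A p) \<and>
     (\<forall>x. critical_pt F x \<and> Fvec F x \<noteq> 0 \<longrightarrow> Fvec F x \<notin> sing_pts A) \<and>
     (\<forall>x. critical_pt F x \<longrightarrow> Fvec F x \<noteq> 0)"

end

(* With C = curl A and e the degree, Euler's formula gives e A = C x y, so (A(F)) is generated by the
   maximal minors of the 3 x 2 matrix with columns F and C(F).  Contracting the integrability condition
   with coordinate fields gives (A(F)) <= I(F^*omega), and I <= K is formal.  For h in K, the ideal
   D = ((A(F)) : h) contains (A(F)) and the coefficients of d(F^*omega); by genericity its zeros lie in
   {F = 0}, where dF has rank 3 off the origin.

   A Jacobian criterion modulo primes, combined with the Nullstellensatz, turns the two dimension bounds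
   (codimension 2 for (A(F)), codimension 3 for D) into polynomials g1, g2 in (A(F)) and g3 in D such that
   g1 is monic in a direction v, g2 is v-invariant and monic in a direction w, and g3 is v- and w-invariant.
   Monic polynomials are non-zero-divisors modulo invariant ones, so g3, g2, g1 is a regular sequence, and
   the Hilbert-Burch syzygies of the minors show that g3 h in (A(F)) implies h in (A(F)). *)

theory Submission
  imports Defs "HOL-Computational_Algebra.Fundamental_Theorem_Algebra"
begin

section \<open>Ideals of commutative rings\<close>

text \<open>An ideal of maximal minors of codimension two is unmixed: a polynomial multiplied into
  it by an ideal of codimension three already belongs to it. Here dimension theory and unmixedness
  are replaced by explicit elements. Codimension greater than r is witnessed by a nonzero element
  that is constant along r directions. If an ideal has no such element, some prime P containing it
  has none either; the zeros of P then project dominantly along these directions, so P has height at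
  most r, which shows as Jacobian rank at most r modulo P. The geometry contradicts this: for r = 1
  the finiteness of the singular set puts all q_l F_i - q_i F_l for a fixed vector q into P, and for
  r = 2 all F_i lie in P, so that at a general zero of P the three differentials dF_i would be
  dependent. That zero must be found away from the origin, where genericity asserts nothing.\<close>

definition is_ideal :: "'a::comm_ring_1 set \<Rightarrow> bool" where
  "is_ideal J \<longleftrightarrow> 0 \<in> J \<and> (\<forall>a\<in>J. \<forall>b\<in>J. a + b \<in> J) \<and> (\<forall>r. \<forall>a\<in>J. r * a \<in> J)"

definition prime_ideal :: "'a::comm_ring_1 set \<Rightarrow> bool" where
  "prime_ideal P \<longleftrightarrow> is_ideal P \<and> 1 \<notin> P \<and> (\<forall>a b. a * b \<in> P \<longrightarrow> a \<in> P \<or> b \<in> P)"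

lemma ideal_zero: "is_ideal J \<Longrightarrow> 0 \<in> J"
  and ideal_add: "is_ideal J \<Longrightarrow> a \<in> J \<Longrightarrow> b \<in> J \<Longrightarrow> a + b \<in> J"
  and ideal_mult: "is_ideal J \<Longrightarrow> a \<in> J \<Longrightarrow> r * a \<in> J"
  by (auto simp: is_ideal_def)

lemma ideal_mult_right: "is_ideal J \<Longrightarrow> a \<in> J \<Longrightarrow> a * r \<in> J"
  using ideal_mult[of J a r] by (simp add: mult.commute)

lemma ideal_diff: "is_ideal J \<Longrightarrow> a \<in> J \<Longrightarrow> b \<in> J \<Longrightarrow> a - b \<in> J"
  using ideal_add[of J a "(-1) * b"] ideal_mult[of J b "-1"] by simp

lemma ideal_add_cancel: "is_ideal J \<Longrightarrow> b \<in> J \<Longrightarrow> a + b \<in> J \<longleftrightarrow> a \<in> J"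
  using ideal_add[of J a b] ideal_diff[of J "a + b" b] by auto

lemma ideal_sum: "is_ideal J \<Longrightarrow> (\<And>i. i \<in> A \<Longrightarrow> f i \<in> J) \<Longrightarrow> sum f A \<in> J"
  by (induction A rule: infinite_finite_induct) (auto simp: ideal_zero ideal_add)

lemma prime_idealD:
  assumes "prime_ideal P"
  shows "is_ideal P" "1 \<notin> P" "a * b \<in> P \<Longrightarrow> a \<in> P \<or> b \<in> P"
  using assms by (auto simp: prime_ideal_def)

lemma prime_ideal_prod:
  assumes "prime_ideal P" "finite S" "prod f S \<in> P"
  shows "\<exists>i\<in>S. f i \<in> P"
  using assms(2,3) by (induction S) (use prime_idealD[OF assms(1)] in auto)

lemma prime_ideal_power:
  assumes "prime_ideal P" "a ^ k \<in> P"
  shows "a \<in> P"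
  using assms(2) by (induction k) (use prime_idealD[OF assms(1)] in auto)

lemma ideal_adjoin:
  assumes "is_ideal J"
  shows "is_ideal {r * a + p | r p. p \<in> J}"
  unfolding is_ideal_def
proof (intro conjI ballI allI)
  show "0 \<in> {r * a + p | r p. p \<in> J}"
    using ideal_zero[OF assms] by (intro CollectI exI[of _ 0]) auto
next
  fix x y assume "x \<in> {r * a + p | r p. p \<in> J}" "y \<in> {r * a + p | r p. p \<in> J}"
  then obtain r p r' p' where "x = r * a + p" "p \<in> J" "y = r' * a + p'" "p' \<in> J" by blast
  then show "x + y \<in> {r * a + p | r p. p \<in> J}"
    using ideal_add[OF assms, of p p']
    by (intro CollectI exI[of _ "r + r'"] exI[of _ "p + p'"]) (auto simp: algebra_simps)
next
  fix s x assume "x \<in> {r * a + p | r p. p \<in> J}"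
  then obtain r p where "x = r * a + p" "p \<in> J" by blast
  then show "s * x \<in> {r * a + p | r p. p \<in> J}"
    using ideal_mult[OF assms, of p s]
    by (intro CollectI exI[of _ "s * r"] exI[of _ "s * p"]) (auto simp: algebra_simps)
qed

text \<open>An ideal maximal among those disjoint from a multiplicative set is prime. The last
  clause keeps the maximality itself, which the Nullstellensatz uses to invert elements up to a
  power of a polynomial.\<close>

lemma prime_ideal_avoiding:
  assumes J: "is_ideal J" and M: "1 \<in> M" "\<And>a b. a \<in> M \<Longrightarrow> b \<in> M \<Longrightarrow> a * b \<in> M"
    and JM: "J \<inter> M = {}"
  obtains P where "prime_ideal P" "J \<subseteq> P" "P \<inter> M = {}"
    "\<And>a. a \<notin> P \<Longrightarrow> \<exists>r. \<exists>p\<in>P. r * a + p \<in> M"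
proof -
  define \<A> where "\<A> = {K. is_ideal K \<and> J \<subseteq> K \<and> K \<inter> M = {}}"
  have "\<exists>P\<in>\<A>. \<forall>X\<in>\<A>. P \<subseteq> X \<longrightarrow> X = P"
  proof (rule subset_Zorn_nonempty)
    show "\<A> \<noteq> {}" using J JM by (auto simp: \<A>_def)
  next
    fix \<C> assume ne: "\<C> \<noteq> {}" and ch: "subset.chain \<A> \<C>"
    then have C: "\<And>K. K \<in> \<C> \<Longrightarrow> is_ideal K \<and> J \<subseteq> K \<and> K \<inter> M = {}"
      by (auto simp: subset.chain_def \<A>_def)
    have dir: "K \<subseteq> L \<or> L \<subseteq> K" if "K \<in> \<C>" "L \<in> \<C>" for K L
      using ch that by (auto simp: subset_chain_def)
    have "is_ideal (\<Union>\<C>)"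
      unfolding is_ideal_def
    proof (intro conjI ballI allI)
      show "0 \<in> \<Union>\<C>" using ne C ideal_zero by blast
    next
      fix a b assume "a \<in> \<Union>\<C>" "b \<in> \<Union>\<C>"
      then obtain K L where "K \<in> \<C>" "a \<in> K" "L \<in> \<C>" "b \<in> L" by blast
      with dir[of K L] obtain N where "N \<in> \<C>" "a \<in> N" "b \<in> N" by blast
      then show "a + b \<in> \<Union>\<C>" using C ideal_add by blast
    next
      fix r a assume "a \<in> \<Union>\<C>"
      then show "r * a \<in> \<Union>\<C>" using C ideal_mult by blast
    qed
    then show "\<Union>\<C> \<in> \<A>" using C ne unfolding \<A>_def by blast
  qed
  then obtain P where P: "is_ideal P" "J \<subseteq> P" "P \<inter> M = {}"
    and max: "\<And>X. is_ideal X \<Longrightarrow> J \<subseteq> X \<Longrightarrow> X \<inter> M = {} \<Longrightarrow> P \<subseteq> X \<Longrightarrow> X = P"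
    by (auto simp: \<A>_def)
  have mx: "\<exists>r. \<exists>p\<in>P. r * a + p \<in> M" if "a \<notin> P" for a
  proof (rule ccontr)
    assume no: "\<not> ?thesis"
    let ?X = "{r * a + p | r p. p \<in> P}"
    have "P \<subseteq> ?X"
    proof
      fix p assume "p \<in> P"
      then show "p \<in> ?X" by (intro CollectI exI[of _ 0] exI[of _ p]) auto
    qed
    moreover have "a \<in> ?X"
      using ideal_zero[OF P(1)] by (intro CollectI exI[of _ 1] exI[of _ 0]) auto
    moreover have "?X \<inter> M = {}" using no by auto
    moreover have "J \<subseteq> ?X" using \<open>P \<subseteq> ?X\<close> P(2) by (rule order_trans[rotated])
    ultimately have "?X = P" using max[OF ideal_adjoin[OF P(1), of a]] by simp
    then show False using \<open>a \<in> ?X\<close> that by simp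
  qed
  have "a \<in> P \<or> b \<in> P" if ab: "a * b \<in> P" for a b
  proof (rule ccontr)
    assume "\<not> ?thesis"
    then obtain r p s q where h: "p \<in> P" "r * a + p \<in> M" "q \<in> P" "s * b + q \<in> M"
      using mx[of a] mx[of b] by blast
    have "(r * a + p) * (s * b + q) = (r * s) * (a * b) + (p * (s * b + q) + (r * a) * q)"
      by (simp add: algebra_simps)
    also have "\<dots> \<in> P" 
      by (rule ideal_add[OF P(1) ideal_mult[OF P(1) ab]
            ideal_add[OF P(1) ideal_mult_right[OF P(1) h(1)] ideal_mult[OF P(1) h(3)]]])
    finally show False using M(2) h P(3) by blast
  qed
  moreover have "1 \<notin> P" using P(3) M(1) by blast
  ultimately have "prime_ideal P" using P(1) by (auto simp: prime_ideal_def)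
  then show thesis using that P mx by blast
qed

section \<open>The ring of polynomial functions\<close>

lemma polyfun_diff: "polyfun f \<Longrightarrow> polyfun g \<Longrightarrow> polyfun (\<lambda>x. f x - g x)"
  using padd[of f "\<lambda>x. (-1) * g x"] pmult[OF pconst[of "-1"], of g] by simp

lemma polyfun_line:
  assumes "polyfun f"
  shows "\<exists>r. \<forall>t. f (x + t *s v) = poly r t"
  using assms
proof induction
  case (pconst c)
  show ?case by (rule exI[of _ "[:c:]"]) simp
next
  case (pvar i)
  show ?case by (rule exI[of _ "[:x $ i, v $ i:]"]) simp
next
  case (padd f g)
  then obtain r s where "\<forall>t. f (x + t *s v) = poly r t" "\<forall>t. g (x + t *s v) = poly s t" by blast
  then show ?case by (intro exI[of _ "r + s"]) simp
next
  case (pmult f g)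
  then obtain r s where "\<forall>t. f (x + t *s v) = poly r t" "\<forall>t. g (x + t *s v) = poly s t" by blast
  then show ?case by (intro exI[of _ "r * s"]) simp
qed

text \<open>A type of its own makes the polynomial functions an instance of \<open>idom\<close>, so
  that \<open>poly\<close> and \<open>dvd\<close> are available over them.\<close>

typedef ('n::finite) mpol = "{f :: complex^'n \<Rightarrow> complex. polyfun f}"
  morphisms mev Mpol
  using pconst by blast

setup_lifting type_definition_mpol

instantiation mpol :: (finite) comm_ring_1
begin

lift_definition zero_mpol :: "'a mpol" is "\<lambda>x. 0" by (rule pconst)
lift_definition one_mpol :: "'a mpol" is "\<lambda>x. 1" by (rule pconst)
lift_definition plus_mpol :: "'a mpol \<Rightarrow> 'a mpol \<Rightarrow> 'a mpol" is "\<lambda>f g x. f x + g x" by (rule padd)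
lift_definition minus_mpol :: "'a mpol \<Rightarrow> 'a mpol \<Rightarrow> 'a mpol" is "\<lambda>f g x. f x - g x"
  by (rule polyfun_diff)
lift_definition uminus_mpol :: "'a mpol \<Rightarrow> 'a mpol" is "\<lambda>f x. - f x"
  subgoal for f using polyfun_diff[OF pconst[of 0], of f] by simp done
lift_definition times_mpol :: "'a mpol \<Rightarrow> 'a mpol \<Rightarrow> 'a mpol" is "\<lambda>f g x. f x * g x" by (rule pmult)

instance
  by standard (transfer; force simp: fun_eq_iff algebra_simps)+

end

lift_definition mconst :: "complex \<Rightarrow> 'n::finite mpol" is "\<lambda>c x. c" by (rule pconst)
lift_definition mvar :: "'n \<Rightarrow> 'n::finite mpol" is "\<lambda>i x. x $ i" by (rule pvar)

lemma mev_simps [simp]: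
  "mev 0 x = 0" "mev 1 x = 1" "mev (p + q) x = mev p x + mev q x"
  "mev (p - q) x = mev p x - mev q x" "mev (- p) x = - mev p x"
  "mev (p * q) x = mev p x * mev q x" "mev (mconst c) x = c" "mev (mvar i) x = x $ i"
  by (transfer; simp)+

lemma mev_sum [simp]: "mev (sum f A) x = (\<Sum>i\<in>A. mev (f i) x)"
  by (induction A rule: infinite_finite_induct) auto

lemma mev_prod [simp]: "mev (prod f A) x = (\<Prod>i\<in>A. mev (f i) x)"
  by (induction A rule: infinite_finite_induct) auto

lemma mpol_eqI: "(\<And>x. mev p x = mev q x) \<Longrightarrow> p = q"
  by transfer auto

lemma polyfun_mev: "polyfun (mev p)"
  using mev[of p] by simp

lemma mev_Mpol: "polyfun f \<Longrightarrow> mev (Mpol f) = f"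
  by (simp add: Mpol_inverse)

lemma mpol_induct [case_names const var add mult]:
  fixes Q :: "'n::finite mpol \<Rightarrow> bool"
  assumes c: "\<And>c. Q (mconst c)" and v: "\<And>i. Q (mvar i)"
    and a: "\<And>p q. Q p \<Longrightarrow> Q q \<Longrightarrow> Q (p + q)" and m: "\<And>p q. Q p \<Longrightarrow> Q q \<Longrightarrow> Q (p * q)"
  shows "Q p"
proof -
  have "Q (Mpol f)" if "polyfun f" for f
    using that
  proof induction
    case (pconst c)
    have "Mpol (\<lambda>x. c) = (mconst c :: 'n mpol)" by (simp add: mconst.abs_eq eq_onp_same_args polyfun.pconst)
    then show ?case using c by simp
  next
    case (pvar i)
    have "Mpol (\<lambda>x. x $ i) = mvar i" by (simp add: mvar.abs_eq eq_onp_same_args polyfun.pvar)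
    then show ?case using v by simp
  next
    case (padd f g)
    have "Mpol (\<lambda>x. f x + g x) = Mpol f + Mpol g"
      using padd by (intro mpol_eqI) (simp add: mev_Mpol polyfun.padd)
    then show ?case using a padd by simp
  next
    case (pmult f g)
    have "Mpol (\<lambda>x. f x * g x) = Mpol f * Mpol g"
      using pmult by (intro mpol_eqI) (simp add: mev_Mpol polyfun.pmult)
    then show ?case using m pmult by simp
  qed
  from this[OF polyfun_mev[of p]] show ?thesis by (simp add: mev_inverse)
qed

text \<open>Factors that are nonzero at different points \<open>a\<close> and \<open>b\<close> are
  compared on the line through both, where they become nonzero univariate polynomials.\<close>

instance mpol :: (finite) idom
proof
  fix p q :: "'a mpol"
  assume "p \<noteq> 0" "q \<noteq> 0"
  then obtain a b where a: "mev p a \<noteq> 0" and b: "mev q b \<noteq> 0"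
    using mpol_eqI[of p 0] mpol_eqI[of q 0] by force
  obtain r s where r: "\<forall>t. mev p (a + t *s (b - a)) = poly r t"
    and s: "\<forall>t. mev q (a + t *s (b - a)) = poly s t"
    using polyfun_line[OF polyfun_mev] by metis
  have "poly r 0 \<noteq> 0" "poly s 1 \<noteq> 0"
    using a b r[rule_format, of 0] s[rule_format, of 1] by (auto simp: vec_eq_iff)
  then have "r * s \<noteq> 0" by auto
  then obtain t where "poly (r * s) t \<noteq> 0" using poly_all_0_iff_0 by blast
  then have "mev (p * q) (a + t *s (b - a)) \<noteq> 0" using r s by simp
  then show "p * q \<noteq> 0" by (metis mev_simps(1))
qed

lemma mconst_0 [simp]: "mconst 0 = 0" and mconst_1 [simp]: "mconst 1 = 1"
  and mconst_add: "mconst (a + b) = mconst a + mconst b"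
  and mconst_mult: "mconst (a * b) = mconst a * mconst b"
  and mconst_diff: "mconst (a - b) = mconst a - mconst b"
  by (auto intro!: mpol_eqI)

lemma mconst_eq_iff [simp]: "mconst a = mconst b \<longleftrightarrow> a = b"
  by (metis mev_simps(7))

lemma mconst_unit: "c \<noteq> 0 \<Longrightarrow> mconst (inverse c) * mconst c = 1"
  by (auto intro!: mpol_eqI)

lemma prime_ideal_mconst: "prime_ideal P \<Longrightarrow> mconst c \<in> P \<longleftrightarrow> c = 0"
  by (metis ideal_mult ideal_zero mconst_0 mconst_unit prime_idealD(1,2))

section \<open>Hilbert's Nullstellensatz\<close>

interpretation mp: vector_space "\<lambda>c p. mconst c * p :: 'n::finite mpol"
  by standard (auto simp: mconst_add mconst_mult algebra_simps)

primrec monoms :: "nat \<Rightarrow> 'n::finite mpol set" where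
  "monoms 0 = {1}"
| "monoms (Suc d) = monoms d \<union> (\<lambda>(i, m). mvar i * m) ` (UNIV \<times> monoms d)"

lemma finite_monoms: "finite (monoms d)"
  by (induction d) auto

lemma monoms_mono: "a \<le> b \<Longrightarrow> monoms a \<subseteq> monoms b"
  by (induction b) (auto simp: le_Suc_eq)

lemma monoms_mult: "p \<in> monoms a \<Longrightarrow> q \<in> monoms b \<Longrightarrow> p * q \<in> monoms (a + b)"
proof (induction a arbitrary: p)
  case (Suc a)
  from Suc.prems(1) consider "p \<in> monoms a" | i m where "m \<in> monoms a" "p = mvar i * m" by auto
  then show ?case
  proof cases
    case 1
    then show ?thesis using Suc.IH[OF 1 Suc.prems(2)] by simp
  next
    case 2
    then show ?thesis using Suc.IH[OF 2(1) Suc.prems(2)] by (force simp: mult.assoc)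
  qed
qed simp

lemma span_monoms_mult:
  assumes "p \<in> mp.span (monoms a)" "q \<in> mp.span (monoms b)"
  shows "p * q \<in> mp.span (monoms (a + b))"
  using assms(1)
proof (induction rule: mp.span_induct_alt)
  case base
  then show ?case by (simp add: mp.span_zero)
next
  case (step c m y)
  have "m * q \<in> mp.span (monoms (a + b))"
    using assms(2)
  proof (induction rule: mp.span_induct_alt)
    case base
    then show ?case by (simp add: mp.span_zero)
  next
    case (step c' m' y')
    have "m * (mconst c' * m' + y') = mconst c' * (m * m') + m * y'" by (simp add: algebra_simps)
    then show ?case
      using mp.span_add[OF mp.span_scale[OF mp.span_base[OF
            monoms_mult[OF \<open>m \<in> monoms a\<close> step(1)]], of c'] step(2)]
      by simp
  qed
  moreover have "(mconst c * m + y) * q = mconst c * (m * q) + y * q" by (simp add: algebra_simps)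
  ultimately show ?case
    using mp.span_add[OF mp.span_scale[of "m * q" _ c] step(2)] by simp
qed

lemma ex_span_monoms: "\<exists>d. p \<in> mp.span (monoms d)"
proof (induction p rule: mpol_induct)
  case (const c)
  have "mconst c * 1 \<in> mp.span (monoms 0)" by (intro mp.span_scale mp.span_base) simp
  then show ?case by (intro exI[of _ 0]) simp
next
  case (var i)
  have "mvar i * 1 \<in> monoms (Suc 0)" by force
  then have "mvar i * 1 \<in> mp.span (monoms (Suc 0))" by (rule mp.span_base)
  then show ?case by (intro exI[of _ "Suc 0"]) simp
next
  case (add p q)
  then obtain a b where "p \<in> mp.span (monoms a)" "q \<in> mp.span (monoms b)" by blast
  then have "p \<in> mp.span (monoms (max a b))" "q \<in> mp.span (monoms (max a b))"
    using mp.span_mono[OF monoms_mono[of a "max a b"]] mp.span_mono[OF monoms_mono[of b "max a b"]]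
    by auto
  then show ?case using mp.span_add by blast
next
  case (mult p q)
  then show ?case using span_monoms_mult by blast
qed

lemma ex_mpol_univariate: "\<exists>q. \<forall>x. mev q x = poly r (x $ i)"
proof (induction r)
  case 0
  show ?case by (rule exI[of _ 0]) simp
next
  case (pCons c r)
  then obtain q where "\<forall>x. mev q x = poly r (x $ i)" by blast
  then show ?case by (intro exI[of _ "mconst c + mvar i * q"]) simp
qed

text \<open>Over the complex numbers \<open>r\<close> splits into linear factors, and primality
  picks one of them.\<close>

lemma prime_ideal_univariate:
  assumes P: "prime_ideal P" and "r \<noteq> 0" "\<And>x. mev q x = poly r (x $ i)" "q \<in> P"
  shows "\<exists>c. mvar i - mconst c \<in> P"
  using assms(2-)
proof (induction "degree r" arbitrary: r q)
  case 0
  then obtain c where c: "r = [:c:]" using degree_eq_zeroE by metis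
  then have "q = mconst c" using 0 by (intro mpol_eqI) simp
  then show ?case using 0 c prime_ideal_mconst[OF P] by auto
next
  case (Suc n)
  then have "\<not> constant (poly r)" using constant_degree by (metis nat.distinct(1))
  then obtain z where "poly r z = 0" using fundamental_theorem_of_algebra by blast
  then obtain s where s: "r = [:-z, 1:] * s" by (metis dvdE poly_eq_0_iff_dvd)
  obtain u where u: "\<forall>x. mev u x = poly s (x $ i)" using ex_mpol_univariate by blast
  have "q = (mvar i - mconst z) * u"
    using Suc.prems u s by (intro mpol_eqI) (simp add: algebra_simps)
  then consider "mvar i - mconst z \<in> P" | "u \<in> P" using Suc.prems prime_idealD(3)[OF P] by metis
  then show ?case
  proof cases
    case 2
    have "s \<noteq> 0" using s Suc.prems by auto
    then have "n = degree s" using s Suc.hyps(2) degree_mult_eq[of "[:-z, 1:]" s] by simp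
    then show ?thesis using Suc.hyps(1)[of s u] 2 u \<open>s \<noteq> 0\<close> by blast
  qed blast
qed

text \<open>Uncountability of the complex numbers enters the Nullstellensatz here: a countable
  labelling has an infinite class.\<close>

lemma ex_infinite_fiber:
  fixes g :: "complex \<Rightarrow> 'b::countable"
  shows "\<exists>k. infinite {c. g c = k}"
proof (rule ccontr)
  assume "\<not> ?thesis"
  then have "countable (\<Union>k. {c. g c = k})"
    by (intro countable_UN) (auto simp: countable_finite)
  moreover have "(\<Union>k. {c. g c = k}) = UNIV" by auto
  ultimately show False using uncountable_UNIV_complex by simp
qed

text \<open>If no \<^term>\<open>mvar i - mconst c\<close> lay in the ideal, each of them would have an inverse in the
  localised quotient. Uncountably many of these inverses cannot be linearly independent,
  because the quotient has countable dimension; clearing denominators in a linear relation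
  gives a univariate polynomial in the ideal.\<close>

lemma maximal_avoiding_var:
  assumes P: "prime_ideal P" and f: "\<And>k. f ^ k \<notin> P"
    and mx: "\<And>a. a \<notin> P \<Longrightarrow> \<exists>r. \<exists>p\<in>P. \<exists>k. r * a + p = f ^ k"
  shows "\<exists>c. mvar i - mconst c \<in> (P :: 'n::finite mpol set)"
proof (rule ccontr)
  note I = prime_idealD(1)[OF P]
  let ?x = "\<lambda>c. mvar i - mconst c :: 'n mpol"
  assume "\<not> ?thesis"
  then have "\<forall>c. \<exists>r p k. p \<in> P \<and> r * ?x c + p = f ^ k" using mx by blast
  then obtain R p m where Rp: "\<forall>c. p c \<in> P \<and> R c * ?x c + p c = f ^ m c" by metis
  then have p: "\<And>c. p c \<in> P" and R: "\<And>c. R c * ?x c + p c = f ^ m c" using Rp by blast+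
  have "\<forall>c. \<exists>d. R c \<in> mp.span (monoms d)" using ex_span_monoms by blast
  then obtain d where d: "\<forall>c. R c \<in> mp.span (monoms (d c))" using choice by metis
  \<comment> \<open>Fixing both labels puts the chosen \<open>R c\<close> into one
    finite-dimensional space and gives them the same power of \<open>f\<close>.\<close>
  obtain md where "infinite {c. (m c, d c) = md}" 
    using ex_infinite_fiber[of "\<lambda>c. (m c, d c)"] by blast
  then obtain k e where inf: "infinite {c. m c = k \<and> d c = e}" by (cases md) auto
  then obtain B where B: "B \<subseteq> {c. m c = k \<and> d c = e}" "finite B"
    "card B = Suc (card (monoms e :: 'n mpol set))"
    using infinite_arbitrarily_large[OF inf] by blast
  have inj: "inj_on R B"
  proof (rule inj_onI)
    fix c c' assume c: "c \<in> B" "c' \<in> B" "R c = R c'"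
    have "mconst (c' - c) * R c = (R c * ?x c + p c) - (R c' * ?x c' + p c') - (p c - p c')"
      using c(3) by (simp add: mconst_diff algebra_simps)
    moreover have "m c = m c'" using c B(1) by auto
    then have "(R c * ?x c + p c) - (R c' * ?x c' + p c') - (p c - p c') = p c' - p c"
      unfolding R by simp
    also have "\<dots> \<in> P" using p ideal_diff[OF I] by blast
    finally have "mconst (c' - c) \<in> P \<or> R c \<in> P" using prime_idealD(3)[OF P] by blast
    moreover have "R c \<notin> P"
      using R[of c] f[of "m c"] ideal_add[OF I ideal_mult_right[OF I, of "R c" "?x c"] p[of c]] by auto
    ultimately show "c = c'" using prime_ideal_mconst[OF P] by auto
  qed
  have "R ` B \<subseteq> mp.span (monoms e)" using d B by auto
  then have "mp.dependent (R ` B)"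
    using mp.independent_span_bound[OF finite_monoms, of "R ` B" e] B(3) card_image[OF inj] by auto
  then obtain u where u: "\<exists>v\<in>R ` B. u v \<noteq> 0" "(\<Sum>v\<in>R ` B. mconst (u v) * v) = 0"
    using mp.dependent_finite[of "R ` B"] B(2) by auto
  define l where "l c = u (R c)" for c
  have l: "(\<Sum>c\<in>B. mconst (l c) * R c) = 0"
    using u(2) by (simp add: sum.reindex[OF inj] l_def)
  obtain z where z: "z \<in> B" "l z \<noteq> 0" using u(1) by (auto simp: l_def)
  \<comment> \<open>The relation says that the inverses of the \<open>?x c\<close>, weighted by
    \<open>l c\<close>, sum to zero. \<open>S\<close> is the numerator of that sum, and
    \<open>r\<close> is \<open>S\<close> as a univariate polynomial.\<close>
  define S where "S = (\<Sum>c\<in>B. mconst (l c) * (\<Prod>b\<in>B-{c}. ?x b))"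
  define r where "r = (\<Sum>c\<in>B. smult (l c) (\<Prod>b\<in>B-{c}. [:-b, 1:]))"
  have "f ^ k * S = (\<Sum>c\<in>B. mconst (l c) * (\<Prod>b\<in>B-{c}. ?x b) * (R c * ?x c + p c))"
    unfolding S_def sum_distrib_left using B(1) R by (intro sum.cong) (auto simp: mult_ac)
  also have "\<dots> = (\<Sum>c\<in>B. mconst (l c) * R c * (\<Prod>b\<in>B. ?x b))
      + (\<Sum>c\<in>B. mconst (l c) * (\<Prod>b\<in>B-{c}. ?x b) * p c)"
    unfolding sum.distrib[symmetric]
    by (intro sum.cong refl) (simp add: prod.remove[OF B(2)] algebra_simps)
  also have "\<dots> = (\<Sum>c\<in>B. mconst (l c) * (\<Prod>b\<in>B-{c}. ?x b) * p c)"
    using l by (simp add: sum_distrib_right[symmetric])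
  also have "\<dots> \<in> P" by (intro ideal_sum[OF I] ideal_mult[OF I] p)
  finally have "S \<in> P" using prime_idealD(3)[OF P] f by blast
  moreover have "mev S x = poly r (x $ i)" for x
    by (simp add: S_def r_def poly_sum poly_prod algebra_simps)
  moreover have "r \<noteq> 0"
  proof
    assume "r = 0"
    \<comment> \<open>As in Lagrange interpolation, only the summand of \<open>z\<close> survives at
      \<open>z\<close>.\<close>
    have "poly r z = (\<Sum>c\<in>B. if c = z then l z * (\<Prod>b\<in>B-{z}. z - b) else 0)"
      unfolding r_def poly_sum using z B(2) by (intro sum.cong) (auto simp: poly_prod)
    also have "\<dots> = l z * (\<Prod>b\<in>B-{z}. z - b)" using z B(2) by simp
    finally show False using \<open>r = 0\<close> z B(2) by auto
  qed
  ultimately have "\<exists>c. ?x c \<in> P" using prime_ideal_univariate[OF P] by blast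
  with \<open>\<not> ?thesis\<close> show False by blast
qed

text \<open>An ideal \<open>N\<close> above \<open>P\<close> that is maximal among those avoiding
  the powers of \<open>f\<close> acts as a maximal ideal of the localisation at \<open>f\<close>:
  modulo \<open>N\<close> every polynomial equals its value at one point, and if \<open>f\<close>
  vanished there it would lie in \<open>N\<close>.\<close>

theorem nullstellensatz:
  assumes P: "prime_ideal P" and van: "\<And>x. (\<And>p. p \<in> P \<Longrightarrow> mev p x = 0) \<Longrightarrow> mev f x = 0"
  shows "f \<in> P"
proof (rule ccontr)
  assume "f \<notin> P"
  then have "P \<inter> range (\<lambda>k. f ^ k) = {}" using prime_ideal_power[OF P] by auto
  then obtain N where N: "prime_ideal N" "P \<subseteq> N" "N \<inter> range (\<lambda>k. f ^ k) = {}"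
    and mx: "\<And>a. a \<notin> N \<Longrightarrow> \<exists>r. \<exists>p\<in>N. r * a + p \<in> range (\<lambda>k. f ^ k)"
    using prime_ideal_avoiding[OF prime_idealD(1)[OF P], of "range (\<lambda>k. f ^ k)"]
    by (smt (verit) image_iff power_0 power_add rangeI)
  note I = prime_idealD(1)[OF N(1)]
  have "\<exists>c. mvar i - mconst c \<in> N" for i
  proof (rule maximal_avoiding_var[OF N(1), of f])
    show "f ^ k \<notin> N" for k using N(3) by auto
    show "\<exists>r. \<exists>p\<in>N. \<exists>k. r * a + p = f ^ k" if "a \<notin> N" for a using mx[OF that] by auto
  qed
  then obtain a where a: "\<And>i. mvar i - mconst (a i) \<in> N" by metis
  let ?a = "\<chi> i. a i"
  have ev: "p - mconst (mev p ?a) \<in> N" for p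
  proof (induction p rule: mpol_induct)
    case (const c)
    show ?case using ideal_zero[OF I] by simp
  next
    case (var i)
    show ?case using a by simp
  next
    case (add p q)
    from ideal_add[OF I this] show ?case by (simp add: mconst_add algebra_simps)
  next
    case (mult p q)
    from ideal_add[OF I ideal_mult[OF I mult(1), of q] ideal_mult[OF I mult(2), of "mconst (mev p ?a)"]]
    show ?case by (simp add: mconst_mult algebra_simps)
  qed
  have "mev p ?a = 0" if "p \<in> P" for p
  proof -
    have "p - (p - mconst (mev p ?a)) \<in> N" using ideal_diff[OF I _ ev] that N(2) by blast
    then show ?thesis using prime_ideal_mconst[OF N(1)] by simp
  qed
  then have "mev f ?a = 0" using van by blast
  then have "f \<in> N" using ev[of f] by simp
  then have "f ^ 1 \<in> N" by simp
  then show False using N(3) by blast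
qed

section \<open>Translations and monic polynomials\<close>

text \<open>A nonzero polynomial over a domain has finitely many roots, and there are infinitely
  many constants. This makes \<open>tay\<close> well defined.\<close>

lemma poly_mconst_eqI:
  fixes P Q :: "'n::finite mpol poly"
  assumes "\<And>t x. mev (poly P (mconst t)) x = mev (poly Q (mconst t)) x"
  shows "P = Q"
proof (rule ccontr)
  assume "P \<noteq> Q"
  then have "finite {a. poly (P - Q) a = 0}" by (intro poly_roots_finite) simp
  moreover have "range mconst \<subseteq> {a. poly (P - Q) a = 0}"
    using assms by (auto intro!: mpol_eqI)
  moreover have "infinite (range (mconst :: complex \<Rightarrow> 'n mpol))"
    using finite_imageD[of "mconst :: complex \<Rightarrow> 'n mpol" UNIV] infinite_UNIV_char_0
    by (auto simp: inj_on_def)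
  ultimately show False using finite_subset by blast
qed

text \<open>\<^term>\<open>tay v p\<close> is \<open>p(x + t v)\<close> as a polynomial in \<open>t\<close> over the polynomial functions of \<open>x\<close>.\<close>

definition tay :: "complex^'n \<Rightarrow> 'n::finite mpol \<Rightarrow> 'n mpol poly" where
  "tay v p = (THE P. \<forall>t x. mev (poly P (mconst t)) x = mev p (x + t *s v))"

lemma tay: "mev (poly (tay v p) (mconst t)) x = mev p (x + t *s v)"
proof -
  have "\<exists>P. \<forall>t x. mev (poly P (mconst t)) x = mev p (x + t *s v)"
  proof (induction p rule: mpol_induct)
    case (const c)
    show ?case by (rule exI[of _ "[:mconst c:]"]) simp
  next
    case (var i)
    show ?case by (rule exI[of _ "[:mvar i, mconst (v $ i):]"]) simp
  next
    case (add p q)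
    then obtain P Q where "\<forall>t x. mev (poly P (mconst t)) x = mev p (x + t *s v)"
      "\<forall>t x. mev (poly Q (mconst t)) x = mev q (x + t *s v)" by blast
    then show ?case by (intro exI[of _ "P + Q"]) simp
  next
    case (mult p q)
    then obtain P Q where "\<forall>t x. mev (poly P (mconst t)) x = mev p (x + t *s v)"
      "\<forall>t x. mev (poly Q (mconst t)) x = mev q (x + t *s v)" by blast
    then show ?case by (intro exI[of _ "P * Q"]) simp
  qed
  then have "\<exists>!P. \<forall>t x. mev (poly P (mconst t)) x = mev p (x + t *s v)"
    by (auto intro: poly_mconst_eqI)
  from theI'[OF this] show ?thesis by (simp add: tay_def)
qed

lemma tay_const [simp]: "tay v (mconst c) = [:mconst c:]"
  and tay_0 [simp]: "tay v 0 = 0"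
  and tay_var [simp]: "tay v (mvar i) = [:mvar i, mconst (v $ i):]"
  and tay_add: "tay v (p + q) = tay v p + tay v q"
  and tay_mult: "tay v (p * q) = tay v p * tay v q"
  by (auto intro!: poly_mconst_eqI simp: tay)

lemma tay_sum: "tay v (sum f A) = (\<Sum>i\<in>A. tay v (f i))"
  by (induction A rule: infinite_finite_induct) (auto simp: tay_add)

lemma coeff_tay_0: "coeff (tay v p) 0 = p"
proof (rule mpol_eqI)
  fix x show "mev (coeff (tay v p) 0) x = mev p x"
    using tay[of v p 0 x] by (simp add: poly_0_coeff_0)
qed

lemma poly_map_mev: "poly (map_poly (\<lambda>q. mev q x) P) t = mev (poly P (mconst t)) x"
  by (induction P) (auto simp: map_poly_pCons)

lemma mev_poly: "mev (poly P s) x = mev (poly P (mconst (mev s x))) x"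
  by (induction P) auto

text \<open>The polynomials pulled back along the projection that forgets the directions in
  \<open>W\<close>: a coordinate-free form of the subring in fewer variables, suited to directions
  that are not coordinate axes.\<close>

definition Inv :: "(complex^'n) set \<Rightarrow> 'n::finite mpol set" where
  "Inv W = {p. \<forall>v\<in>W. \<forall>t x. mev p (x + t *s v) = mev p x}"

lemma Inv_one [simp]: "1 \<in> Inv W" and Inv_zero [simp]: "0 \<in> Inv W"
  and Inv_diff: "p \<in> Inv W \<Longrightarrow> q \<in> Inv W \<Longrightarrow> p - q \<in> Inv W"
  and Inv_mult: "p \<in> Inv W \<Longrightarrow> q \<in> Inv W \<Longrightarrow> p * q \<in> Inv W"
  by (auto simp: Inv_def)

lemma tay_Inv: "p \<in> Inv W \<Longrightarrow> v \<in> W \<Longrightarrow> tay v p = [:p:]"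
  by (intro poly_mconst_eqI) (simp add: tay Inv_def)

text \<open>Translations along \<open>v\<close> and \<open>w\<close> commute, so p(x + r v + t w)
  and p(x + t w) agree as polynomials in t.\<close>

lemma coeff_tay_Inv:
  assumes "p \<in> Inv W"
  shows "coeff (tay w p) i \<in> Inv W"
  unfolding Inv_def
proof (intro CollectI ballI allI)
  fix v r x assume v: "v \<in> W"
  have "poly (map_poly (\<lambda>q. mev q (x + r *s v)) (tay w p)) t
      = poly (map_poly (\<lambda>q. mev q x) (tay w p)) t" for t
  proof -
    have "mev p (x + r *s v + t *s w) = mev p ((x + t *s w) + r *s v)"
      by (simp add: algebra_simps)
    then show ?thesis using assms v by (simp add: poly_map_mev tay Inv_def)
  qed
  then have "map_poly (\<lambda>q. mev q (x + r *s v)) (tay w p) = map_poly (\<lambda>q. mev q x) (tay w p)"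
    by (subst poly_eq_poly_eq_iff[symmetric]) (rule ext)
  then have "coeff (map_poly (\<lambda>q. mev q (x + r *s v)) (tay w p)) i
      = coeff (map_poly (\<lambda>q. mev q x) (tay w p)) i" by simp
  then show "mev (coeff (tay w p) i) (x + r *s v) = mev (coeff (tay w p) i) x"
    by (simp add: coeff_map_poly)
qed

lemma ex_mpol_subst: "\<exists>q. \<forall>x. mev q x = mev p (\<chi> i. mev (u i) x)"
proof (induction p rule: mpol_induct)
  case (const c)
  show ?case by (rule exI[of _ "mconst c"]) simp
next
  case (var i)
  show ?case by (rule exI[of _ "u i"]) simp
next
  case (add p q)
  then obtain p' q' where "\<forall>x. mev p' x = mev p (\<chi> i. mev (u i) x)"
    "\<forall>x. mev q' x = mev q (\<chi> i. mev (u i) x)" by blast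
  then show ?case by (intro exI[of _ "p' + q'"]) simp
next
  case (mult p q)
  then obtain p' q' where "\<forall>x. mev p' x = mev p (\<chi> i. mev (u i) x)"
    "\<forall>x. mev q' x = mev q (\<chi> i. mev (u i) x)" by blast
  then show ?case by (intro exI[of _ "p' * q'"]) simp
qed

text \<open>\<open>s\<close> is a coordinate along \<open>w\<close>, and x - s(x) w is the
  projection along \<open>w\<close> onto s = 0. The Taylor coefficients of \<open>p\<close> at the
  projected point are constant along \<open>w\<close>, and moving back by s(x) recovers
  \<open>p\<close>.\<close>

lemma Inv_expand:
  fixes s :: "'n::finite mpol"
  assumes s: "\<And>x t. mev s (x + t *s w) = mev s x + t" "s \<in> Inv W" and p: "p \<in> Inv W"
  obtains Y where "\<And>i. coeff Y i \<in> Inv (insert w W)" "poly Y s = p"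
proof -
  have "\<exists>\<phi>. \<forall>q x. mev (\<phi> q) x = mev q (x - mev s x *s w)"
  proof (rule choice, rule allI)
    fix q :: "'n mpol"
    have "x - mev s x *s w = (\<chi> i. mev (mvar i - s * mconst (w $ i)) x)" for x
      by (simp add: vec_eq_iff)
    then show "\<exists>q'. \<forall>x. mev q' x = mev q (x - mev s x *s w)"
      using ex_mpol_subst[of q "\<lambda>i. mvar i - s * mconst (w $ i)"] by simp
  qed
  then obtain \<phi> where \<phi>: "\<And>q x. mev (\<phi> q) x = mev q (x - mev s x *s w)" by blast
  have \<phi>0: "\<phi> 0 = 0" by (intro mpol_eqI) (simp add: \<phi>)
  define Y where "Y = map_poly \<phi> (tay w p)"
  have "coeff Y i \<in> Inv (insert w W)" for i
  proof -
    let ?c = "coeff (tay w p) i"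
    have 1: "x + t *s w - mev s (x + t *s w) *s w = x - mev s x *s w" for x t
      unfolding s by (simp add: vec_eq_iff algebra_simps)
    have 2: "mev ?c (x + t *s v - mev s (x + t *s v) *s w) = mev ?c (x - mev s x *s w)"
      if "v \<in> W" for x t v
    proof -
      have a: "mev s (x + t *s v) = mev s x" using that s(2) by (simp add: Inv_def)
      have b: "x + t *s v - mev s x *s w = (x - mev s x *s w) + t *s v" by simp
      show ?thesis unfolding a b using coeff_tay_Inv[OF p, of w i] that unfolding Inv_def by blast
    qed
    have "mev (\<phi> ?c) (x + t *s v) = mev (\<phi> ?c) x" if "v \<in> insert w W" for x t v
    proof (cases "v = w")
      case True
      then show ?thesis by (simp only: \<phi> 1)
    next
      case False
      then have "v \<in> W" using that by blast
      then show ?thesis unfolding \<phi> by (rule 2)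
    qed
    then show ?thesis
      unfolding Y_def coeff_map_poly[of \<phi>, OF \<phi>0] Inv_def by blast
  qed
  moreover have "poly Y s = p"
  proof (rule mpol_eqI)
    fix x
    have "mev (poly (map_poly \<phi> P) (mconst a)) x = mev (poly P (mconst a)) (x - mev s x *s w)" for P a
      by (induction P) (auto simp: map_poly_pCons \<phi>0 \<phi>)
    then show "mev (poly Y s) x = mev p x"
      by (subst mev_poly) (simp add: Y_def tay)
  qed
  ultimately show thesis using that by blast
qed

section \<open>Monic polynomials as non-zero-divisors\<close>

definition monic_along :: "complex^'n \<Rightarrow> 'n::finite mpol \<Rightarrow> bool" where
  "monic_along v g \<longleftrightarrow> (\<exists>c. c \<noteq> 0 \<and> lead_coeff (tay v g) = mconst c)"

text \<open>Let \<open>k\<close> be the top index with \<open>coeff Y k\<close> outside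
  \<open>J\<close>. In degree \<open>degree G + k\<close> of the product all other terms lie in
  \<open>J\<close>, and the leading coefficient of \<open>G\<close> is a unit.\<close>

lemma coeff_mult_monic_cancel:
  fixes G Y :: "'a::comm_ring_1 poly"
  assumes J: "is_ideal J" and u: "u * lead_coeff G = 1" and GY: "\<And>i. coeff (G * Y) i \<in> J"
  shows "coeff Y i \<in> J"
proof (rule ccontr)
  assume "coeff Y i \<notin> J"
  let ?S = "{k. coeff Y k \<notin> J}"
  define k where "k = Max ?S"
  have "?S \<subseteq> {..degree Y}" using ideal_zero[OF J] by (auto intro: le_degree)
  then have fin: "finite ?S" by (rule finite_subset) simp
  then have k: "coeff Y k \<notin> J" using Max_in[OF fin] \<open>coeff Y i \<notin> J\<close> by (auto simp: k_def)
  have big: "coeff Y j \<in> J" if "j > k" for j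
    using Max_ge[OF fin, of j] that by (auto simp: k_def)
  let ?d = "degree G"
  have "coeff (G * Y) (?d + k) = (\<Sum>i\<le>?d + k. coeff G i * coeff Y (?d + k - i))"
    by (rule coeff_mult)
  also have "\<dots> = coeff G ?d * coeff Y k + (\<Sum>i\<in>{..?d + k} - {?d}. coeff G i * coeff Y (?d + k - i))"
    by (subst sum.remove[of _ ?d]) auto
  finally have e: "coeff (G * Y) (?d + k) = \<dots>" .
  have "(\<Sum>i\<in>{..?d + k} - {?d}. coeff G i * coeff Y (?d + k - i)) \<in> J"
  proof (rule ideal_sum[OF J])
    fix i assume i: "i \<in> {..?d + k} - {?d}"
    show "coeff G i * coeff Y (?d + k - i) \<in> J"
    proof (cases "i < ?d")
      case True
      then show ?thesis by (intro ideal_mult[OF J] big) simp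
    next
      case False
      then have "coeff G i = 0" using i by (intro coeff_eq_0) auto
      then show ?thesis using ideal_zero[OF J] by simp
    qed
  qed
  then have "coeff G ?d * coeff Y k \<in> J" using GY[of "?d + k"] e ideal_add_cancel[OF J] by metis
  then have "u * (coeff G ?d * coeff Y k) \<in> J" by (rule ideal_mult[OF J])
  then show False using k u by (simp add: mult.assoc[symmetric])
qed

lemma ideal_two: "is_ideal {c * y + d * z | y z. True}"
  for c d :: "'a::comm_ring_1"
  unfolding is_ideal_def
proof (intro conjI ballI allI)
  show "0 \<in> {c * y + d * z | y z. True}" by (intro CollectI exI[of _ 0]) simp
next
  fix a b assume "a \<in> {c * y + d * z | y z. True}" "b \<in> {c * y + d * z | y z. True}"
  then obtain y z y' z' where "a = c * y + d * z" "b = c * y' + d * z'" by blast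
  then show "a + b \<in> {c * y + d * z | y z. True}"
    by (intro CollectI exI[of _ "y + y'"] exI[of _ "z + z'"]) (simp add: algebra_simps)
next
  fix r a assume "a \<in> {c * y + d * z | y z. True}"
  then obtain y z where "a = c * y + d * z" by blast
  then show "r * a \<in> {c * y + d * z | y z. True}"
    by (intro CollectI exI[of _ "r * y"] exI[of _ "r * z"]) (simp add: algebra_simps)
qed

text \<open>Expanded along \<open>v\<close>, the factors \<open>c\<close> and \<open>d\<close> are
  constants, so every coefficient of the product lies in (c, d). Cancelling \<open>g\<close> and
  taking the coefficient of index 0 returns \<open>X\<close> itself.\<close>

lemma monic_along_regular2:
  assumes g: "monic_along v g" and c: "c \<in> Inv {v}" "d \<in> Inv {v}" and e: "g * X = c * a + d * b"
  shows "\<exists>y z. X = c * y + d * z"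
proof -
  let ?J = "{c * y + d * z | y z. True}"
  obtain k where k: "k \<noteq> 0" "lead_coeff (tay v g) = mconst k" using g by (auto simp: monic_along_def)
  have "tay v g * tay v X = [:c:] * tay v a + [:d:] * tay v b"
    using arg_cong[OF e, of "tay v"] c by (simp add: tay_mult tay_add tay_Inv)
  then have "coeff (tay v g * tay v X) i \<in> ?J" for i by auto
  from coeff_mult_monic_cancel[OF ideal_two _ this, of "mconst (inverse k)" 0]
  have "coeff (tay v X) 0 \<in> ?J" by (simp add: k mconst_unit)
  then show ?thesis by (auto simp: coeff_tay_0)
qed

lemma monic_along_regular1:
  assumes "monic_along v g" "c \<in> Inv {v}" "g * X = c * a"
  shows "c dvd X"
  using monic_along_regular2[of v g c 0 X a 0] assms by auto

text \<open>The homogeneous polynomials of degree \<open>k\<close>, in terms of the two facts about them that are needed.\<close>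

definition homogs :: "nat \<Rightarrow> 'n::finite mpol set" where
  "homogs k = {h. \<forall>v. degree (tay v h) \<le> k \<and> coeff (tay v h) k = mconst (mev h v)}"

lemma homogs_0 [simp]: "0 \<in> homogs k"
  by (simp add: homogs_def)

lemma homogs_add: "p \<in> homogs k \<Longrightarrow> q \<in> homogs k \<Longrightarrow> p + q \<in> homogs k"
  by (auto simp: homogs_def tay_add mconst_add degree_add_le)

lemma homogs_sum: "(\<And>i. i \<in> A \<Longrightarrow> f i \<in> homogs k) \<Longrightarrow> sum f A \<in> homogs k"
  by (induction A rule: infinite_finite_induct) (auto simp: homogs_add)

lemma homogs_mult:
  assumes "p \<in> homogs k" "q \<in> homogs l"
  shows "p * q \<in> homogs (k + l)"
  unfolding homogs_def
proof (intro CollectI allI conjI)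
  fix v
  let ?P = "tay v p" and ?Q = "tay v q"
  have d: "degree ?P \<le> k" "degree ?Q \<le> l" using assms by (auto simp: homogs_def)
  then show "degree (tay v (p * q)) \<le> k + l"
    using degree_mult_le[of ?P ?Q] by (simp add: tay_mult)
  have "coeff ?P i * coeff ?Q (k + l - i) = 0" if "i \<noteq> k" "i \<le> k + l" for i
    using that d by (cases "i < k") (auto simp: coeff_eq_0)
  then have "(\<Sum>i\<le>k + l. coeff ?P i * coeff ?Q (k + l - i))
      = (\<Sum>i\<in>{k}. coeff ?P i * coeff ?Q (k + l - i))"
    by (intro sum.mono_neutral_right) auto
  then show "coeff (tay v (p * q)) (k + l) = mconst (mev (p * q) v)"
    using assms by (simp add: tay_mult coeff_mult homogs_def mconst_mult)
qed

text \<open>The coefficients of \<open>P\<close> are the homogeneous parts; the auxiliary variable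
  records the degree, so that products of decompositions are again decompositions.\<close>

lemma homogs_decompose:
  fixes p :: "'n::finite mpol"
  shows "\<exists>P. (\<forall>k. coeff P k \<in> homogs k) \<and> poly P 1 = p"
proof (induction p rule: mpol_induct)
  case (const c)
  have "coeff [:mconst c :: 'n mpol:] k \<in> homogs k" for k by (cases k) (auto simp: homogs_def)
  then show ?case by (intro exI[of _ "[:mconst c:]"]) simp
next
  case (var i)
  have "coeff [:0, mvar i:] k \<in> homogs k" for k
    by (cases k; cases "k - 1") (auto simp: homogs_def)
  then show ?case by (intro exI[of _ "[:0, mvar i:]"]) simp
next
  case (add p q)
  then obtain P Q where "\<forall>k. coeff P k \<in> homogs k" "poly P 1 = p"
    "\<forall>k. coeff Q k \<in> homogs k" "poly Q 1 = q" by blast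
  then show ?case by (intro exI[of _ "P + Q"]) (simp add: homogs_add)
next
  case (mult p q)
  then obtain P Q where P: "\<And>k. coeff P k \<in> homogs k" "poly P 1 = p"
    "\<And>k. coeff Q k \<in> homogs k" "poly Q 1 = q" by blast
  have "coeff (P * Q) k \<in> homogs k" for k
    unfolding coeff_mult
  proof (rule homogs_sum)
    fix i assume "i \<in> {..k}"
    then show "coeff P i * coeff Q (k - i) \<in> homogs k"
      using homogs_mult[OF P(1)[of i] P(3)[of "k - i"]] by simp
  qed
  then show ?case using P by (intro exI[of _ "P * Q"]) simp
qed

text \<open>The top coefficient in t of g(x + t v) is the value at \<open>v\<close> of the top
  homogeneous part of \<open>g\<close>, so any \<open>v\<close> where that part does not vanish will
  do.\<close>

lemma ex_monic_along:
  assumes "g \<noteq> 0"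
  obtains v where "monic_along v g"
proof -
  obtain P where P: "\<And>k. coeff P k \<in> homogs k" "poly P 1 = g" using homogs_decompose by blast
  let ?d = "degree P"
  have "lead_coeff P \<noteq> 0" using P(2) assms by auto
  then obtain v where v: "mev (coeff P ?d) v \<noteq> 0" using mpol_eqI[of "lead_coeff P" 0] by auto
  have T: "tay v g = (\<Sum>k\<le>?d. tay v (coeff P k))"
    by (simp add: P(2)[symmetric] poly_altdef tay_sum)
  have deg: "degree (tay v (coeff P k)) \<le> k" for k using P(1)[of k] by (auto simp: homogs_def)
  have "degree (tay v g) \<le> ?d"
    unfolding T by (intro degree_sum_le) (auto intro: order_trans[OF deg])
  moreover have "coeff (tay v g) ?d = mconst (mev (coeff P ?d) v)"
  proof -
    have "coeff (tay v g) ?d = (\<Sum>k\<in>{?d}. coeff (tay v (coeff P k)) ?d)"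
      unfolding T coeff_sum using deg
      by (intro sum.mono_neutral_right) (auto intro!: coeff_eq_0 le_less_trans[OF deg])
    then show ?thesis using P(1)[of ?d] by (simp add: homogs_def)
  qed
  moreover from this have "coeff (tay v g) ?d \<noteq> 0"
    using v mconst_eq_iff[of "mev (coeff P ?d) v" 0] by simp
  ultimately have "degree (tay v g) = ?d" by (simp add: le_antisym le_degree)
  then have "monic_along v g"
    using v \<open>coeff (tay v g) ?d = _\<close> unfolding monic_along_def by auto
  then show thesis by (rule that)
qed

section \<open>Partial derivatives\<close>

lemma polyfun_line_DERIV:
  "((\<lambda>t. mev p (x + t *s v)) has_field_derivative deriv (\<lambda>t. mev p (x + t *s v)) 0) (at 0)"
proof -
  obtain r where "\<forall>t. mev p (x + t *s v) = poly r t" using polyfun_line[OF polyfun_mev] by blast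
  then have "(\<lambda>t. mev p (x + t *s v)) = poly r" by auto
  then show ?thesis using poly_DERIV[of r 0] DERIV_imp_deriv by metis
qed

lemma pd_mev_simps:
  "pd j (mev (mconst c)) x = 0"
  "pd j (mev (mvar i)) x = (if i = j then 1 else 0)"
  "pd j (mev (p + q)) x = pd j (mev p) x + pd j (mev q) x"
  "pd j (mev (p * q)) x = pd j (mev p) x * mev q x + mev p x * pd j (mev q) x"
proof -
  note d = polyfun_line_DERIV[where v = "axis j 1" and x = x]
  show "pd j (mev (mconst c)) x = 0" by (simp add: pd_def)
  show "pd j (mev (mvar i)) x = (if i = j then 1 else 0)"
    unfolding pd_def by (rule DERIV_imp_deriv) (auto intro!: derivative_eq_intros simp: axis_def)
  show "pd j (mev (p + q)) x = pd j (mev p) x + pd j (mev q) x"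
    unfolding pd_def using DERIV_imp_deriv[OF DERIV_add[OF d[of p] d[of q]]] by simp
  show "pd j (mev (p * q)) x = pd j (mev p) x * mev q x + mev p x * pd j (mev q) x"
    unfolding pd_def using DERIV_imp_deriv[OF DERIV_mult[OF d[of p] d[of q]]]
    by (simp add: algebra_simps)
qed

definition mD :: "'n \<Rightarrow> 'n::finite mpol \<Rightarrow> 'n mpol" where
  "mD j p = Mpol (pd j (mev p))"

lemma mev_mD: "mev (mD j p) = pd j (mev p)"
proof -
  have "\<exists>q. \<forall>x. mev q x = pd j (mev p) x"
  proof (induction p rule: mpol_induct)
    case (const c)
    show ?case by (rule exI[of _ 0]) (simp add: pd_def)
  next
    case (var i)
    have "mev (mconst (if i = j then 1 else 0)) x = pd j (mev (mvar i)) x" for x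
      by (subst pd_mev_simps(2)) (rule mev_simps(7))
    then show ?case by blast
  next
    case (add p q)
    then obtain p' q' where "\<forall>x. mev p' x = pd j (mev p) x" "\<forall>x. mev q' x = pd j (mev q) x" by blast
    then have "mev (p' + q') x = pd j (mev (p + q)) x" for x
      by (subst pd_mev_simps(3)) simp
    then show ?case by blast
  next
    case (mult p q)
    then obtain p' q' where "\<forall>x. mev p' x = pd j (mev p) x" "\<forall>x. mev q' x = pd j (mev q) x" by blast
    then have "mev (p' * q + p * q') x = pd j (mev (p * q)) x" for x
      by (subst pd_mev_simps(4)) simp
    then show ?case by blast
  qed
  then obtain q where "mev q = pd j (mev p)" by auto
  then show ?thesis unfolding mD_def by (metis mev_inverse)
qed

lemma mD_const [simp]: "mD j (mconst c) = 0"
  and mD_var: "mD j (mvar i) = (if i = j then 1 else 0)"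
  and mD_add: "mD j (p + q) = mD j p + mD j q"
  and mD_mult: "mD j (p * q) = mD j p * q + p * mD j q"
  by (auto intro!: mpol_eqI simp: mev_mD pd_mev_simps)

lemma mD_0 [simp]: "mD j 0 = 0" and mD_1 [simp]: "mD j 1 = 0"
  using mD_const[of j 0] mD_const[of j 1] by auto

lemma mD_diff: "mD j (p - q) = mD j p - mD j q"
  using mD_add[of j "p - q" q] by simp

lemma mD_sum: "mD j (sum f A) = (\<Sum>i\<in>A. mD j (f i))"
  by (induction A rule: infinite_finite_induct) (auto simp: mD_add)

lemma mD_commute: "mD i (mD j p) = mD j (mD i p)"
  by (induction p rule: mpol_induct) (auto simp: mD_var mD_add mD_mult algebra_simps)

section \<open>Substitution, chain rule and Euler's identity\<close>

definition mcomp :: "'m::finite mpol \<Rightarrow> ('m \<Rightarrow> 'n::finite mpol) \<Rightarrow> 'n mpol" where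
  "mcomp p u = Mpol (\<lambda>x. mev p (\<chi> i. mev (u i) x))"

lemma mev_mcomp [simp]: "mev (mcomp p u) x = mev p (\<chi> i. mev (u i) x)"
proof -
  obtain q where "\<forall>x. mev q x = mev p (\<chi> i. mev (u i) x)" using ex_mpol_subst by blast
  then have "mev q = (\<lambda>x. mev p (\<chi> i. mev (u i) x))" by auto
  then show ?thesis unfolding mcomp_def by (metis mev_inverse)
qed

lemma mcomp_simps:
  "mcomp (mconst c) u = mconst c" "mcomp (mvar i) u = u i"
  "mcomp (p + q) u = mcomp p u + mcomp q u" "mcomp (p * q) u = mcomp p u * mcomp q u"
  "mcomp 0 u = 0" "mcomp 1 u = 1" "mcomp (p - q) u = mcomp p u - mcomp q u"
  by (auto intro!: mpol_eqI)

lemma mD_mcomp: "mD j (mcomp p u) = (\<Sum>i\<in>UNIV. mcomp (mD i p) u * mD j (u i))"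
proof (induction p rule: mpol_induct)
  case (var k)
  have "(\<Sum>i\<in>UNIV. mcomp (mD i (mvar k)) u * mD j (u i)) = (\<Sum>i\<in>UNIV. if i = k then mD j (u i) else 0)"
    by (intro sum.cong) (auto simp: mD_var mcomp_simps)
  then show ?case by (simp add: mcomp_simps)
next
  case (add p q)
  then show ?case by (simp add: mD_add mcomp_simps sum.distrib algebra_simps)
next
  case (mult p q)
  then show ?case
    by (simp add: mD_mult mcomp_simps sum.distrib sum_distrib_left sum_distrib_right algebra_simps)
qed (simp add: mcomp_simps)

lemma mev_ray_DERIV:
  "((\<lambda>t. mev p (t *s x)) has_field_derivative (\<Sum>i\<in>UNIV. x $ i * mev (mD i p) (t *s x))) (at t)"
proof (induction p rule: mpol_induct)
  case (const c)
  show ?case by simp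
next
  case (var k)
  have "(\<Sum>i\<in>UNIV. x $ i * mev (mD i (mvar k)) (t *s x)) = (\<Sum>i\<in>UNIV. if i = k then x $ i else 0)"
    by (intro sum.cong) (auto simp: mD_var)
  then show ?case by (auto intro!: derivative_eq_intros)
next
  case (add p q)
  from DERIV_add[OF this] show ?case by (simp add: mD_add sum.distrib algebra_simps)
next
  case (mult p q)
  from DERIV_mult[OF this] show ?case
    by (simp add: mD_mult sum.distrib sum_distrib_left sum_distrib_right algebra_simps)
qed

lemma euler_identity:
  assumes "\<And>t x. mev p (t *s x) = t ^ d * mev p x"
  shows "(\<Sum>i\<in>UNIV. x $ i * mev (mD i p) x) = of_nat d * mev p x"
proof -
  have "((\<lambda>t. t ^ d * mev p x) has_field_derivative (of_nat d * mev p x)) (at 1)"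
    by (auto intro!: derivative_eq_intros)
  moreover have "((\<lambda>t. t ^ d * mev p x) has_field_derivative (\<Sum>i\<in>UNIV. x $ i * mev (mD i p) x)) (at 1)"
    using mev_ray_DERIV[of p x 1] assms by simp
  ultimately show ?thesis by (rule DERIV_unique[symmetric])
qed

section \<open>Jacobian rank modulo a prime ideal\<close>

text \<open>Over the fraction field of the quotient by \<open>P\<close>, the differentials of the
  elements of \<open>P \<inter> T\<close> lie in the span of \<open>r\<close> fixed covectors; the
  factors \<sigma> stand for denominators. For \<open>T = UNIV\<close> this replaces the statement
  that \<open>P\<close> has height at most \<open>r\<close>.\<close>

definition jac_rank_le :: "'n::finite mpol set \<Rightarrow> 'n mpol set \<Rightarrow> nat \<Rightarrow> bool" where
  "jac_rank_le P T r \<longleftrightarrow> (\<exists>G. \<forall>p\<in>P \<inter> T. \<exists>\<sigma> c. \<sigma> \<notin> P \<and>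
     (\<forall>j. \<sigma> * mD j p - (\<Sum>i<r. c i * G i j) \<in> P))"

lemma jac_rank_le_Suc:
  assumes "jac_rank_le P T r"
  shows "jac_rank_le P T (Suc r)"
proof -
  from assms obtain G where G: "\<And>p. p \<in> P \<inter> T \<Longrightarrow> \<exists>\<sigma> c. \<sigma> \<notin> P \<and>
     (\<forall>j. \<sigma> * mD j p - (\<Sum>i<r. c i * G i j) \<in> P)"
    unfolding jac_rank_le_def by blast
  show ?thesis
    unfolding jac_rank_le_def
  proof (intro exI[of _ G] ballI)
    fix p assume "p \<in> P \<inter> T"
    then obtain \<sigma> c where h: "\<sigma> \<notin> P" "\<And>j. \<sigma> * mD j p - (\<Sum>i<r. c i * G i j) \<in> P"
      using G by blast
    show "\<exists>\<sigma> c. \<sigma> \<notin> P \<and> (\<forall>j. \<sigma> * mD j p - (\<Sum>i<Suc r. c i * G i j) \<in> P)"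
      using h by (intro exI[of _ \<sigma>] exI[of _ "c(r := 0)"]) simp
  qed
qed

text \<open>Let \<open>n\<close> have least degree in \<open>s\<close> among the elements of \<open>P \<inter> T[s]\<close> with leading coefficient outside
  \<open>P\<close>. By pseudo-division every element of \<open>P \<inter> T[s]\<close> is, up to a factor outside \<open>P\<close>, a multiple of \<open>n\<close>
  plus a polynomial in \<open>s\<close> with coefficients in \<open>P \<inter> T\<close>, so the differential of \<open>n\<close> is the only new one.\<close>

lemma jac_rank_le_adjoin:
  assumes P: "prime_ideal P" and rk: "jac_rank_le P T r"
    and T: "0 \<in> T" "\<And>a b. a \<in> T \<Longrightarrow> b \<in> T \<Longrightarrow> a - b \<in> T" "\<And>a b. a \<in> T \<Longrightarrow> b \<in> T \<Longrightarrow> a * b \<in> T"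
    and T': "\<And>p. p \<in> T' \<Longrightarrow> \<exists>Y. (\<forall>i. coeff Y i \<in> T) \<and> poly Y s = p"
  shows "jac_rank_le P T' (Suc r)"
proof -
  note I = prime_idealD(1)[OF P] and one = prime_idealD(2)[OF P] and pr = prime_idealD(3)[OF P]
  obtain G where G: "\<And>p. p \<in> P \<inter> T \<Longrightarrow> \<exists>\<sigma> c. \<sigma> \<notin> P \<and> (\<forall>j. \<sigma> * mD j p - (\<Sum>i<r. c i * G i j) \<in> P)"
    using rk unfolding jac_rank_le_def by blast
  define minimal where "minimal d Z \<longleftrightarrow> (\<forall>i. coeff Z i \<in> T) \<and> (\<forall>i>d. coeff Z i = 0) \<and> coeff Z d \<notin> P
    \<and> poly Z s \<in> P" for d Z
  define d where "d = (LEAST d. \<exists>Z. minimal d Z)"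
  \<comment> \<open>With the default 0 the case without a minimal \<open>Z\<close> is covered too:
    then the leading coefficients never lie outside \<open>P\<close>, and no new differential is
    needed.\<close>
  define n where "n = (if \<exists>d Z. minimal d Z then poly (SOME Z. minimal d Z) s else 0)"
  have Z: "minimal d (SOME Z. minimal d Z)" if "minimal d' Z'" for d' Z'
  proof (rule someI_ex)
    show "\<exists>Z. minimal d Z"
      unfolding d_def by (rule LeastI[of "\<lambda>d. \<exists>Z. minimal d Z" d']) (rule exI[of _ Z'], rule that)
  qed
  have nP: "n \<in> P"
  proof (cases "\<exists>d Z. minimal d Z")
    case True
    then have "minimal d (SOME Z. minimal d Z)" using Z by blast
    then have "poly (SOME Z. minimal d Z) s \<in> P" by (subst (asm) minimal_def) blast
    then show ?thesis using True by (simp only: n_def if_True)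
  next
    case False
    then show ?thesis using ideal_zero[OF I] by (simp only: n_def if_False)
  qed
  define H where "H = G(r := \<lambda>j. mD j n)"
  define good where "good p \<longleftrightarrow> (\<exists>\<sigma> c. \<sigma> \<notin> P \<and> (\<forall>j. \<sigma> * mD j p - (\<Sum>i<Suc r. c i * H i j) \<in> P))" for p
  have good_T: "good p" if p: "p \<in> P" "p \<in> T" for p
  proof -
    obtain \<sigma> c where "\<sigma> \<notin> P" "\<And>j. \<sigma> * mD j p - (\<Sum>i<r. c i * G i j) \<in> P"
      using G[OF IntI[OF p]] by blast
    then show ?thesis
      unfolding good_def H_def by (intro exI[of _ \<sigma>] exI[of _ "c(r := 0)"]) simp
  qed
  have good_n: "good n"
  proof -
    have "(\<Sum>i<Suc r. (if i = r then 1 else 0) * H i j) = mD j n" for j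
      by (simp add: H_def)
    then show ?thesis
      unfolding good_def using one ideal_zero[OF I]
      by (intro exI[of _ 1] exI[of _ "\<lambda>i. if i = r then 1 else 0"]) simp
  qed
  have good_add: "good (p + q)" if pq: "good p" "good q" for p q
  proof -
    obtain \<sigma> c \<tau> e where h: "\<sigma> \<notin> P" "\<And>j. \<sigma> * mD j p - (\<Sum>i<Suc r. c i * H i j) \<in> P"
      "\<tau> \<notin> P" "\<And>j. \<tau> * mD j q - (\<Sum>i<Suc r. e i * H i j) \<in> P"
      using pq unfolding good_def by blast
    have "\<sigma> * \<tau> * mD j (p + q) - (\<Sum>i<Suc r. (\<tau> * c i + \<sigma> * e i) * H i j) \<in> P" for j
    proof -
      have "\<sigma> * \<tau> * mD j (p + q) - (\<Sum>i<Suc r. (\<tau> * c i + \<sigma> * e i) * H i j)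
          = \<tau> * (\<sigma> * mD j p - (\<Sum>i<Suc r. c i * H i j)) + \<sigma> * (\<tau> * mD j q - (\<Sum>i<Suc r. e i * H i j))"
        unfolding mD_add ring_distribs sum.distrib right_diff_distrib sum_distrib_left
        by (simp add: mult_ac)
      then show ?thesis using ideal_add[OF I ideal_mult[OF I h(2)] ideal_mult[OF I h(4)]] by simp
    qed
    moreover have "\<sigma> * \<tau> \<notin> P" using h pr by blast
    ultimately show ?thesis
      unfolding good_def by (intro exI[of _ "\<sigma> * \<tau>"] exI[of _ "\<lambda>i. \<tau> * c i + \<sigma> * e i"]) blast
  qed
  \<comment> \<open>The product rule leaves a multiple of \<open>p\<close> itself, which disappears
    modulo \<open>P\<close> because \<open>p \<in> P\<close>.\<close>
  have good_mult: "good (a * p)" if p: "good p" "p \<in> P" for a p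
  proof -
    obtain \<sigma> c where h: "\<sigma> \<notin> P" "\<And>j. \<sigma> * mD j p - (\<Sum>i<Suc r. c i * H i j) \<in> P"
      using p(1) unfolding good_def by blast
    have "\<sigma> * mD j (a * p) - (\<Sum>i<Suc r. (a * c i) * H i j) \<in> P" for j
    proof -
      have "\<sigma> * mD j (a * p) - (\<Sum>i<Suc r. (a * c i) * H i j)
          = (\<sigma> * mD j a) * p + a * (\<sigma> * mD j p - (\<Sum>i<Suc r. c i * H i j))"
        unfolding mD_mult ring_distribs right_diff_distrib sum_distrib_left
        by (simp add: mult_ac)
      then show ?thesis using ideal_add[OF I ideal_mult[OF I p(2)] ideal_mult[OF I h(2)]] by simp
    qed
    then show ?thesis unfolding good_def using h(1) by (intro exI[of _ \<sigma>] exI[of _ "\<lambda>i. a * c i"]) simp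
  qed
  have good_cancel: "good p" if p: "good (z * p)" "z \<notin> P" "p \<in> P" for z p
  proof -
    obtain \<sigma> c where h: "\<sigma> \<notin> P" "\<And>j. \<sigma> * mD j (z * p) - (\<Sum>i<Suc r. c i * H i j) \<in> P"
      using p(1) unfolding good_def by blast
    have "\<sigma> * z * mD j p - (\<Sum>i<Suc r. c i * H i j) \<in> P" for j
    proof -
      have e: "\<sigma> * z * mD j p - (\<Sum>i<Suc r. c i * H i j)
          = (\<sigma> * mD j (z * p) - (\<Sum>i<Suc r. c i * H i j)) - (\<sigma> * mD j z) * p"
        unfolding mD_mult by (simp add: algebra_simps)
      show ?thesis unfolding e by (rule ideal_diff[OF I h(2) ideal_mult[OF I p(3)]])
    qed
    moreover have "\<sigma> * z \<notin> P" using h p pr by blast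
    ultimately show ?thesis
      unfolding good_def by (intro exI[of _ "\<sigma> * z"] exI[of _ c]) blast
  qed
  \<comment> \<open>The bound \<open>m\<close> lies strictly above all indices in use, so the base
    case is \<open>Y = 0\<close>.\<close>
  have main: "good (poly Y s)"
    if "\<And>i. coeff Y i \<in> T" "\<And>i. i \<ge> m \<Longrightarrow> coeff Y i = 0" "poly Y s \<in> P" for m Y
    using that
  proof (induction m arbitrary: Y)
    case 0
    then have "Y = 0" by (intro poly_eqI) simp
    then show ?case using good_T[of 0] ideal_zero[OF I] T(1) by simp
  next
    case (Suc m)
    let ?a = "coeff Y m"
    show ?case
    proof (cases "?a \<in> P")
      case True
      let ?Y = "Y - monom ?a m"
      have e: "poly ?Y s = poly Y s - s ^ m * ?a" by (simp add: poly_monom mult.commute)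
      have "coeff ?Y i \<in> T" for i using Suc.prems(1) T by (auto simp: coeff_monom)
      moreover have "coeff ?Y i = 0" if "i \<ge> m" for i
        using that Suc.prems(2)[of i] by (cases "i = m") auto
      moreover have "poly ?Y s \<in> P"
        unfolding e by (intro ideal_diff[OF I Suc.prems(3)] ideal_mult[OF I True])
      ultimately have "good (poly ?Y s)" by (rule Suc.IH)
      moreover have "good (s ^ m * ?a)" using True Suc.prems(1) by (intro good_mult good_T)
      ultimately have "good (poly ?Y s + s ^ m * ?a)" by (rule good_add)
      then show ?thesis unfolding e by simp
    next
      case False
      then have mY: "minimal m Y" using Suc.prems by (auto simp: minimal_def)
      define Z where "Z = (SOME Z. minimal d Z)"
      have mZ: "minimal d Z" using Z[OF mY] unfolding Z_def .
      have n: "n = poly Z s" unfolding n_def Z_def using mY by auto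
      have dm: "d \<le> m" unfolding d_def using mY by (intro Least_le) blast
      let ?z = "coeff Z d"
      \<comment> \<open>One step of pseudo-division: the coefficients of index \<open>m\<close>
        cancel. The multiplier \<open>?z\<close> lies outside \<open>P\<close> and is removed by
        \<open>good_cancel\<close>.\<close>
      let ?Y = "smult ?z Y - monom ?a (m - d) * Z"
      have e: "poly ?Y s = ?z * poly Y s - ?a * s ^ (m - d) * n"
        by (simp add: poly_monom n)
      have c: "coeff ?Y i = ?z * coeff Y i - (if i < m - d then 0 else ?a * coeff Z (i - (m - d)))" for i
        by (simp add: coeff_monom_mult)
      have "coeff ?Y i \<in> T" for i
        unfolding c using Suc.prems(1) T mZ by (auto simp: minimal_def)
      moreover have "coeff ?Y i = 0" if "i \<ge> m" for i
      proof (cases "i = m")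
        case True
        then show ?thesis unfolding c using dm by simp
      next
        case False
        then show ?thesis unfolding c using that dm Suc.prems(2)[of i] mZ by (auto simp: minimal_def)
      qed
      moreover have "poly ?Y s \<in> P"
        unfolding e by (intro ideal_diff[OF I] ideal_mult[OF I] Suc.prems(3) nP)
      ultimately have "good (poly ?Y s)" by (rule Suc.IH)
      then have "good (poly ?Y s + ?a * s ^ (m - d) * n)"
        by (intro good_add good_mult good_n nP)
      then have "good (?z * poly Y s)" unfolding e by simp
      moreover have "?z \<notin> P" using mZ unfolding minimal_def by blast
      ultimately show ?thesis using Suc.prems(3) by (rule good_cancel)
    qed
  qed
  have "good p" if p: "p \<in> P \<inter> T'" for p
  proof -
    obtain Y where Y: "\<And>i. coeff Y i \<in> T" "poly Y s = p" using T' p by blast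
    then show ?thesis using main[of Y "Suc (degree Y)"] p by (auto simp: coeff_eq_0)
  qed
  then show ?thesis unfolding jac_rank_le_def good_def by blast
qed

text \<open>Unless \<open>w\<close> is a multiple of \<open>v\<close>, some linear form kills
  \<open>v\<close> and is 1 on \<open>w\<close>. For \<open>v = 0\<close> the divisions by
  \<open>v $ i\<close> yield 0 and the same formulas serve.\<close>

lemma linear_coordinate:
  fixes v w :: "complex^'n::finite"
  obtains c where "w = c *s v"
  | s :: "'n mpol" where "\<And>x t. mev s (x + t *s w) = mev s x + t" "s \<in> Inv {v}"
proof -
  obtain i where i: "v $ i \<noteq> 0 \<or> v = 0" by (metis vec_eq_iff zero_index)
  define u where "u = w - (w $ i / v $ i) *s v"
  show thesis
  proof (cases "u = 0")
    case True
    then show thesis using that(1) unfolding u_def by auto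
  next
    case False
    then obtain j where j: "u $ j \<noteq> 0" by (metis vec_eq_iff zero_index)
    define s where "s = mconst (1 / u $ j) * (mvar j - mconst (v $ j / v $ i) * mvar i)"
    have "mev s (x + t *s w) = mev s x + t * ((w $ j - v $ j / v $ i * w $ i) / u $ j)" for x t
      by (simp add: s_def field_simps add_divide_distrib diff_divide_distrib)
    moreover have "w $ j - v $ j / v $ i * w $ i = u $ j" by (simp add: u_def)
    ultimately have "mev s (x + t *s w) = mev s x + t" for x t using j by simp
    moreover have "s \<in> Inv {v}"
      unfolding Inv_def s_def using i j by (auto simp: field_simps)
    ultimately show thesis using that(2) by blast
  qed
qed

text \<open>Giving up invariance along \<open>w\<close> adjoins one variable and hence at most one
  new differential; if \<open>w\<close> is a multiple of \<open>v\<close>, nothing is given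
  up.\<close>

lemma jac_rank_le_Inv:
  assumes P: "prime_ideal P" and rk: "jac_rank_le P (Inv {w, v}) r"
  shows "jac_rank_le P (Inv {v}) (Suc r)"
proof (rule linear_coordinate[of w v])
  fix c assume w: "w = c *s v"
  have "Inv {v} \<subseteq> Inv {w, v}"
    by (auto simp: Inv_def w vec.scale_scale)
  then show ?thesis using jac_rank_le_Suc[OF rk] unfolding jac_rank_le_def by blast
next
  fix s :: "'a mpol" assume s: "\<And>x t. mev s (x + t *s w) = mev s x + t" "s \<in> Inv {v}"
  show ?thesis
    using P rk
  proof (rule jac_rank_le_adjoin)
    show "\<exists>Y. (\<forall>i. coeff Y i \<in> Inv {w, v}) \<and> poly Y s = p" if "p \<in> Inv {v}" for p
      using Inv_expand[OF s that] by blast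
  qed (auto intro: Inv_diff Inv_mult)
qed

lemma jac_rank_le_0:
  assumes "prime_ideal P" "P \<inter> T \<subseteq> {0}"
  shows "jac_rank_le P T 0"
proof -
  have "1 \<notin> P" "0 \<in> P" using assms(1) prime_idealD ideal_zero by blast+
  then show ?thesis
    unfolding jac_rank_le_def using assms(2) by (auto intro!: exI[of _ 1])
qed

text \<open>The zero direction imposes no condition, so the same descent reaches the whole ring at
  \<open>{0}\<close>.\<close>

lemma Inv_0 [simp]: "Inv {0} = UNIV" and Inv_insert_0: "Inv {v, 0} = Inv {v}"
  by (auto simp: Inv_def)

lemma jac_rank_le_1:
  assumes "prime_ideal P" "P \<inter> Inv {v} \<subseteq> {0}"
  shows "jac_rank_le P UNIV 1"
  using jac_rank_le_Inv[of P v 0 0] jac_rank_le_0[of P "Inv {v}"] assms by (simp add: Inv_insert_0)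

lemma jac_rank_le_2:
  assumes "prime_ideal P" "P \<inter> Inv {w, v} \<subseteq> {0}"
  shows "jac_rank_le P UNIV 2"
  using jac_rank_le_Inv[of P v 0 1] jac_rank_le_Inv[of P w v 0] jac_rank_le_0[of P "Inv {w, v}"] assms
  by (simp add: Inv_insert_0 numeral_2_eq_2)

text \<open>Two linear conditions on three unknowns; the zero third row makes \<open>M\<close>
  singular.\<close>

lemma ex_orthogonal3:
  fixes a b :: "3 \<Rightarrow> complex"
  obtains g :: "complex^3" where "g \<noteq> 0" "(\<Sum>i\<in>UNIV. g $ i * a i) = 0" "(\<Sum>i\<in>UNIV. g $ i * b i) = 0"
proof -
  define M :: "complex^3^3" where "M = (\<chi> i j. if i = 1 then a j else if i = 2 then b j else 0)"
  have "\<not> (\<exists>B. B ** M = mat 1)"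
  proof
    assume "\<exists>B. B ** M = mat 1"
    then obtain B where "M ** B = mat 1" using matrix_left_right_inverse by blast
    then have "(M ** B) $ 3 $ 3 = 1" by (simp add: mat_def)
    then show False by (simp add: matrix_matrix_mult_def M_def)
  qed
  then obtain g where g: "M *v g = 0" "g \<noteq> 0" unfolding matrix_left_invertible_ker by blast
  have "(M *v g) $ 1 = 0" "(M *v g) $ 2 = 0" using g(1) by auto
  then show thesis using that[of g] g(2) by (simp add: matrix_vector_mult_def M_def mult.commute)
qed

section \<open>A Hilbert--Burch argument\<close>

lemma cross_independent:
  fixes f1 f2 f3 c1 c2 c3 x y :: "'a::idom"
  assumes a: "c2 * f3 - c3 * f2 \<noteq> 0 \<or> c3 * f1 - c1 * f3 \<noteq> 0 \<or> c1 * f2 - c2 * f1 \<noteq> 0"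
    and e: "x * f1 + y * c1 = 0" "x * f2 + y * c2 = 0" "x * f3 + y * c3 = 0"
  shows "x = 0 \<and> y = 0"
proof -
  have "y * (c2 * f3 - c3 * f2) = (x * f2 + y * c2) * f3 - (x * f3 + y * c3) * f2"
    "y * (c3 * f1 - c1 * f3) = (x * f3 + y * c3) * f1 - (x * f1 + y * c1) * f3"
    "y * (c1 * f2 - c2 * f1) = (x * f1 + y * c1) * f2 - (x * f2 + y * c2) * f1"
    "x * (c2 * f3 - c3 * f2) = (x * f3 + y * c3) * c2 - (x * f2 + y * c2) * c3"
    "x * (c3 * f1 - c1 * f3) = (x * f1 + y * c1) * c3 - (x * f3 + y * c3) * c1"
    "x * (c1 * f2 - c2 * f1) = (x * f2 + y * c2) * c1 - (x * f1 + y * c1) * c2"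
    by (simp_all add: algebra_simps)
  then show ?thesis unfolding e using a by auto
qed

text \<open>The entries of \<open>a = c \<times> f\<close> are the maximal minors of the \<open>3 \<times> 2\<close> matrix with columns \<open>f\<close> and \<open>c\<close>.
  By Cramer's rule a multiple of \<open>u\<close> by an element of the ideal of minors is a combination of the
  columns; the regular sequence \<open>g1, g2\<close> in that ideal removes the factor.\<close>

lemma cross_syzygy:
  fixes f1 f2 f3 c1 c2 c3 :: "'a::idom"
  defines "a1 \<equiv> c2 * f3 - c3 * f2" and "a2 \<equiv> c3 * f1 - c1 * f3" and "a3 \<equiv> c1 * f2 - c2 * f1"
  assumes g1: "g1 = a1 * p1 + a2 * p2 + a3 * p3" and g2: "g2 = a1 * q1 + a2 * q2 + a3 * q3"
    and nz: "g1 \<noteq> 0" "g2 \<noteq> 0" and reg: "\<And>X b. g1 * X = g2 * b \<Longrightarrow> g2 dvd X"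
    and u: "a1 * u1 + a2 * u2 + a3 * u3 = 0"
  obtains x y where "u1 = x * f1 + y * c1" "u2 = x * f2 + y * c2" "u3 = x * f3 + y * c3"
proof -
  have ann: "\<exists>x y. g * u1 = x * f1 + y * c1 \<and> g * u2 = x * f2 + y * c2 \<and> g * u3 = x * f3 + y * c3"
    if g: "g = a1 * p1 + a2 * p2 + a3 * p3" for g p1 p2 p3
  proof -
    \<comment> \<open>With w = u \<times> p, the coefficients come from a \<times> (u \<times> p) =
      (a . p) u - (a . u) p and (c \<times> f) \<times> w = (c . w) f - (f . w) c.\<close>
    let ?w1 = "u2 * p3 - u3 * p2" and ?w2 = "u3 * p1 - u1 * p3" and ?w3 = "u1 * p2 - u2 * p1"
    let ?x = "c1 * ?w1 + c2 * ?w2 + c3 * ?w3" and ?y = "- (f1 * ?w1 + f2 * ?w2 + f3 * ?w3)"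
    have "g * u1 = ?x * f1 + ?y * c1 + p1 * (a1 * u1 + a2 * u2 + a3 * u3)"
      "g * u2 = ?x * f2 + ?y * c2 + p2 * (a1 * u1 + a2 * u2 + a3 * u3)"
      "g * u3 = ?x * f3 + ?y * c3 + p3 * (a1 * u1 + a2 * u2 + a3 * u3)"
      unfolding g a1_def a2_def a3_def by (simp_all add: algebra_simps)
    then show ?thesis unfolding u by auto
  qed
  obtain x y where x: "g1 * u1 = x * f1 + y * c1" "g1 * u2 = x * f2 + y * c2" "g1 * u3 = x * f3 + y * c3"
    using ann[OF g1] by blast
  obtain x' y' where x': "g2 * u1 = x' * f1 + y' * c1" "g2 * u2 = x' * f2 + y' * c2" "g2 * u3 = x' * f3 + y' * c3"
    using ann[OF g2] by blast
  \<comment> \<open>Comparing the two expressions for g1 g2 u, independence of the columns gives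
    \<open>g1 * x' = g2 * x\<close>; so \<open>g2\<close> divides \<open>x'\<close> and can be
    cancelled.\<close>
  have "g1 * (g2 * u1) = g2 * (g1 * u1)" "g1 * (g2 * u2) = g2 * (g1 * u2)" "g1 * (g2 * u3) = g2 * (g1 * u3)"
    by (simp_all add: mult_ac)
  then have "(g1 * x' - g2 * x) * f1 + (g1 * y' - g2 * y) * c1 = 0"
    "(g1 * x' - g2 * x) * f2 + (g1 * y' - g2 * y) * c2 = 0"
    "(g1 * x' - g2 * x) * f3 + (g1 * y' - g2 * y) * c3 = 0"
    unfolding x x' by (simp_all add: algebra_simps)
  moreover have "c2 * f3 - c3 * f2 \<noteq> 0 \<or> c3 * f1 - c1 * f3 \<noteq> 0 \<or> c1 * f2 - c2 * f1 \<noteq> 0"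
    using nz(1) unfolding g1 a1_def a2_def a3_def by auto
  ultimately have "g1 * x' = g2 * x" "g1 * y' = g2 * y" using cross_independent by fastforce+
  then obtain X Y where "x' = g2 * X" "y' = g2 * Y" using reg by (meson dvdE)
  then have "g2 * u1 = g2 * (X * f1 + Y * c1)" "g2 * u2 = g2 * (X * f2 + Y * c2)"
    "g2 * u3 = g2 * (X * f3 + Y * c3)"
    unfolding x' by (simp_all add: algebra_simps)
  then show thesis using that[of X Y] nz(2) by simp
qed

text \<open>The vectors \<open>g1 u - g3 h p\<close> and \<open>g2 u - g3 h q\<close> are syzygies of \<open>a\<close>. Regularity of \<open>g3, g2, g1\<close> forces
  the coefficients of the first one with respect to \<open>f\<close> and \<open>c\<close> to lie in \<open>(g1, g3)\<close>; hence \<open>g3\<close> divides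
  \<open>u\<close> up to a combination of \<open>f\<close> and \<open>c\<close>.\<close>

lemma cross_nonzerodivisor:
  fixes f1 f2 f3 c1 c2 c3 :: "'a::idom"
  defines "a1 \<equiv> c2 * f3 - c3 * f2" and "a2 \<equiv> c3 * f1 - c1 * f3" and "a3 \<equiv> c1 * f2 - c2 * f1"
  assumes g1: "g1 = a1 * p1 + a2 * p2 + a3 * p3" and g2: "g2 = a1 * q1 + a2 * q2 + a3 * q3"
    and nz: "g1 \<noteq> 0" "g2 \<noteq> 0" "g3 \<noteq> 0"
    and reg12: "\<And>X b. g1 * X = g2 * b \<Longrightarrow> g2 dvd X"
    and reg13: "\<And>X b. g1 * X = g3 * b \<Longrightarrow> g3 dvd X"
    and reg23: "\<And>X b. g2 * X = g3 * b \<Longrightarrow> g3 dvd X"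
    and reg123: "\<And>X b d. g1 * X = g2 * b + g3 * d \<Longrightarrow> \<exists>y z. X = g2 * y + g3 * z"
    and h: "g3 * h = a1 * u1 + a2 * u2 + a3 * u3"
  obtains t1 t2 t3 where "h = a1 * t1 + a2 * t2 + a3 * t3"
proof -
  have syz: "\<exists>x y. u1 = x * f1 + y * c1 \<and> u2 = x * f2 + y * c2 \<and> u3 = x * f3 + y * c3"
    if "a1 * u1 + a2 * u2 + a3 * u3 = 0" for u1 u2 u3
    by (rule cross_syzygy[of g1 c2 f3 c3 f2 p1 f1 c1 p2 p3 g2 q1 q2 q3 u1 u2 u3])
      (use that g1 g2 nz reg12 in \<open>auto simp: a1_def a2_def a3_def\<close>)
  have "a1 * (g1 * u1 - g3 * h * p1) + a2 * (g1 * u2 - g3 * h * p2) + a3 * (g1 * u3 - g3 * h * p3)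
      = g1 * (a1 * u1 + a2 * u2 + a3 * u3) - g3 * h * (a1 * p1 + a2 * p2 + a3 * p3)"
    by (simp add: algebra_simps)
  also have "\<dots> = 0" unfolding g1[symmetric] h[symmetric] by simp
  finally obtain x y where x: "g1 * u1 - g3 * h * p1 = x * f1 + y * c1"
    "g1 * u2 - g3 * h * p2 = x * f2 + y * c2" "g1 * u3 - g3 * h * p3 = x * f3 + y * c3"
    using syz by blast
  have "a1 * (g2 * u1 - g3 * h * q1) + a2 * (g2 * u2 - g3 * h * q2) + a3 * (g2 * u3 - g3 * h * q3)
      = g2 * (a1 * u1 + a2 * u2 + a3 * u3) - g3 * h * (a1 * q1 + a2 * q2 + a3 * q3)"
    by (simp add: algebra_simps)
  also have "\<dots> = 0" unfolding g2[symmetric] h[symmetric] by simp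
  finally obtain x' y' where x': "g2 * u1 - g3 * h * q1 = x' * f1 + y' * c1"
    "g2 * u2 - g3 * h * q2 = x' * f2 + y' * c2" "g2 * u3 - g3 * h * q3 = x' * f3 + y' * c3"
    using syz by blast
  \<comment> \<open>This Koszul syzygy links the other two: \<open>g2\<close> times the first minus
    \<open>g1\<close> times the second is \<open>g3 * h\<close> times it.\<close>
  have "a1 * (g1 * q1 - g2 * p1) + a2 * (g1 * q2 - g2 * p2) + a3 * (g1 * q3 - g2 * p3)
      = g1 * (a1 * q1 + a2 * q2 + a3 * q3) - g2 * (a1 * p1 + a2 * p2 + a3 * p3)"
    by (simp add: algebra_simps)
  also have "\<dots> = 0" unfolding g1[symmetric] g2[symmetric] by simp
  finally obtain x'' y'' where x'': "g1 * q1 - g2 * p1 = x'' * f1 + y'' * c1"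
    "g1 * q2 - g2 * p2 = x'' * f2 + y'' * c2" "g1 * q3 - g2 * p3 = x'' * f3 + y'' * c3"
    using syz by blast
  have key: "(g2 * x - g1 * x' - g3 * h * x'') * f + (g2 * y - g1 * y' - g3 * h * y'') * c = 0"
    if "g1 * u - g3 * h * p = x * f + y * c" "g2 * u - g3 * h * q = x' * f + y' * c"
      "g1 * q - g2 * p = x'' * f + y'' * c" for u p q f c
  proof -
    have "(g2 * x - g1 * x' - g3 * h * x'') * f + (g2 * y - g1 * y' - g3 * h * y'') * c
        = g2 * (x * f + y * c) - g1 * (x' * f + y' * c) - g3 * h * (x'' * f + y'' * c)"
      by (simp add: algebra_simps)
    also have "\<dots> = 0" unfolding that[symmetric] by (simp add: algebra_simps)
    finally show ?thesis .
  qed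
  have "c2 * f3 - c3 * f2 \<noteq> 0 \<or> c3 * f1 - c1 * f3 \<noteq> 0 \<or> c1 * f2 - c2 * f1 \<noteq> 0"
    using nz(1) unfolding g1 a1_def a2_def a3_def by auto
  from cross_independent[OF this key[OF x(1) x'(1) x''(1)] key[OF x(2) x'(2) x''(2)] key[OF x(3) x'(3) x''(3)]]
  have rel: "g2 * x - g1 * x' - g3 * h * x'' = 0" "g2 * y - g1 * y' - g3 * h * y'' = 0" by auto
  \<comment> \<open>Modulo (g2, g3) the relation reads g1 x' = 0, so x' = g2 X + g3 Z; substituting
    this back, \<open>g3\<close> divides g2 (x - g1 X).\<close>
  have lift: "\<exists>X k. x = g1 * X + g3 * k" if r: "g2 * x - g1 * x' - g3 * h * x'' = 0" for x x' x''
  proof -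
    have "g1 * x' = g2 * x + g3 * (- h * x'')" using r by (simp add: algebra_simps)
    then obtain X Z where X: "x' = g2 * X + g3 * Z" using reg123 by blast
    have "g2 * (x - g1 * X) = (g2 * x - g1 * x' - g3 * h * x'') + g3 * (g1 * Z + h * x'')"
      unfolding X by (simp add: algebra_simps)
    then have "g3 dvd x - g1 * X" using reg23 unfolding r by simp
    then obtain k where "x - g1 * X = g3 * k" by (rule dvdE)
    then have "x = g1 * X + g3 * k" by (simp add: algebra_simps)
    then show ?thesis by blast
  qed
  obtain X k where X: "x = g1 * X + g3 * k" using lift[OF rel(1)] by blast
  obtain Y l where Y: "y = g1 * Y + g3 * l" using lift[OF rel(2)] by blast
  have div: "\<exists>t. u = g3 * t + X * f + Y * c" if "g1 * u - g3 * h * p = x * f + y * c" for u p f c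
  proof -
    have "g1 * (u - X * f - Y * c) = (g1 * u - g3 * h * p) - (x * f + y * c) + g3 * (h * p + k * f + l * c)"
      unfolding X Y by (simp add: algebra_simps)
    then have "g3 dvd u - X * f - Y * c" using reg13 unfolding that by simp
    then obtain t where "u - X * f - Y * c = g3 * t" by (rule dvdE)
    then have "u = g3 * t + X * f + Y * c" by (simp add: algebra_simps)
    then show ?thesis by blast
  qed
  obtain t1 t2 t3 where t: "u1 = g3 * t1 + X * f1 + Y * c1" "u2 = g3 * t2 + X * f2 + Y * c2"
    "u3 = g3 * t3 + X * f3 + Y * c3"
    using div[OF x(1)] div[OF x(2)] div[OF x(3)] by blast
  \<comment> \<open>The multiples of \<open>f\<close> and \<open>c\<close> drop out, since c
    \<times> f is orthogonal to both.\<close>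
  have "g3 * h = g3 * (a1 * t1 + a2 * t2 + a3 * t3)"
    unfolding h t a1_def a2_def a3_def by (simp add: algebra_simps)
  then show thesis using that[of t1 t2 t3] nz(3) by simp
qed

section \<open>Finitely generated ideals\<close>

definition ideal_of :: "('i::finite \<Rightarrow> 'a::comm_ring_1) \<Rightarrow> 'a set" where
  "ideal_of a = range (\<lambda>c. \<Sum>i\<in>UNIV. c i * a i)"

lemma ideal_ofI: "(\<Sum>i\<in>UNIV. c i * a i) \<in> ideal_of a"
  by (auto simp: ideal_of_def)

lemma is_ideal_ideal_of: "is_ideal (ideal_of a)"
  unfolding is_ideal_def
proof (intro conjI ballI allI)
  show "0 \<in> ideal_of a" using ideal_ofI[of "\<lambda>_. 0" a] by simp
next
  fix x y assume "x \<in> ideal_of a" "y \<in> ideal_of a"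
  then obtain c d where "x = (\<Sum>i\<in>UNIV. c i * a i)" "y = (\<Sum>i\<in>UNIV. d i * a i)"
    by (auto simp: ideal_of_def)
  then show "x + y \<in> ideal_of a"
    using ideal_ofI[of "\<lambda>i. c i + d i" a] by (simp add: sum.distrib distrib_right)
next
  fix r x assume "x \<in> ideal_of a"
  then obtain c where "x = (\<Sum>i\<in>UNIV. c i * a i)" by (auto simp: ideal_of_def)
  then show "r * x \<in> ideal_of a"
    using ideal_ofI[of "\<lambda>i. r * c i" a] by (simp add: sum_distrib_left mult.assoc)
qed

lemma ideal_of_gen: "a i \<in> ideal_of a"
proof -
  have "(\<Sum>j\<in>UNIV. (if j = i then 1 else 0) * a j) = (\<Sum>j\<in>UNIV. if j = i then a j else 0)"
    by (intro sum.cong) auto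
  then show ?thesis using ideal_ofI[of "\<lambda>j. if j = i then 1 else 0" a] by simp
qed

lemma ideal_of_least: "is_ideal J \<Longrightarrow> (\<And>i. a i \<in> J) \<Longrightarrow> ideal_of a \<subseteq> J"
  by (auto simp: ideal_of_def intro!: ideal_sum ideal_mult)

text \<open>\<open>gen_ideal\<close> works with a set of generators, where equal members of the
  family merge; their coefficients are added over the fibres of the index map.\<close>

lemma gen_ideal_range:
  fixes a :: "'i::finite \<Rightarrow> 'n::finite mpol"
  shows "gen_ideal (range (\<lambda>i. mev (a i))) = mev ` ideal_of a"
proof (intro equalityI subsetI)
  fix h assume "h \<in> gen_ideal (range (\<lambda>i. mev (a i)))"
  then obtain S c where S: "finite S" "S \<subseteq> range (\<lambda>i. mev (a i))"
    and c: "\<And>g. g \<in> S \<Longrightarrow> polyfun (c g)" and h: "h = (\<lambda>x. \<Sum>g\<in>S. c g x * g x)"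
    unfolding gen_ideal_def by blast
  from S(2) have "\<forall>g\<in>S. \<exists>i. g = mev (a i)" by blast
  then obtain idx where idx: "\<And>g. g \<in> S \<Longrightarrow> g = mev (a (idx g))" by metis
  have "(\<Sum>g\<in>S. Mpol (c g) * a (idx g)) \<in> ideal_of a"
    by (intro ideal_sum[OF is_ideal_ideal_of] ideal_mult[OF is_ideal_ideal_of] ideal_of_gen)
  moreover have "mev (\<Sum>g\<in>S. Mpol (c g) * a (idx g)) = h"
  proof
    fix x
    have "mev (\<Sum>g\<in>S. Mpol (c g) * a (idx g)) x = (\<Sum>g\<in>S. c g x * mev (a (idx g)) x)"
      unfolding mev_sum by (intro sum.cong) (auto simp: mev_Mpol c)
    also have "\<dots> = h x"
      unfolding h using idx by (intro sum.cong) auto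
    finally show "mev (\<Sum>g\<in>S. Mpol (c g) * a (idx g)) x = h x" .
  qed
  ultimately show "h \<in> mev ` ideal_of a" by blast
next
  fix h assume "h \<in> mev ` ideal_of a"
  then obtain c where h: "h = mev (\<Sum>i\<in>UNIV. c i * a i)" by (auto simp: ideal_of_def)
  let ?R = "range (\<lambda>i. mev (a i))"
  define d where "d g = mev (\<Sum>i\<in>{i. mev (a i) = g}. c i)" for g
  have "h = (\<lambda>x. \<Sum>g\<in>?R. d g x * g x)"
  proof
    fix x
    have "h x = (\<Sum>i\<in>UNIV. mev (c i) x * mev (a i) x)" by (simp add: h)
    also have "\<dots> = (\<Sum>g\<in>?R. \<Sum>i\<in>{i\<in>UNIV. mev (a i) = g}. mev (c i) x * mev (a i) x)"
      by (rule sum.image_gen) simp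
    also have "\<dots> = (\<Sum>g\<in>?R. d g x * g x)"
      by (intro sum.cong) (auto simp: d_def sum_distrib_right)
    finally show "h x = (\<Sum>g\<in>?R. d g x * g x)" .
  qed
  moreover have "polyfun (d g)" for g unfolding d_def by (rule polyfun_mev)
  ultimately show "h \<in> gen_ideal ?R"
    unfolding gen_ideal_def by (intro CollectI exI[of _ ?R] exI[of _ d]) simp
qed

section \<open>Points of prime ideals\<close>

text \<open>In a domain the nonzero invariant polynomials form a multiplicative set.\<close>

lemma prime_ideal_avoiding_Inv:
  assumes "is_ideal J" "J \<inter> Inv W \<subseteq> {0}"
  obtains P where "prime_ideal P" "J \<subseteq> P" "P \<inter> Inv W \<subseteq> {0}"
proof (rule prime_ideal_avoiding[OF assms(1), of "Inv W - {0}"])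
  fix P assume "prime_ideal P" "J \<subseteq> P" "P \<inter> (Inv W - {0}) = {}"
  then show thesis using that by blast
qed (use assms Inv_mult in auto)

text \<open>Three coordinates suffice: a nonzero vector orthogonal to the restrictions of
  \<open>v\<close> and \<open>w\<close> supplies the coefficients.\<close>

lemma ex_Inv_linear:
  fixes v w :: "complex^'n::finite"
  assumes "CARD('n) \<ge> 3"
  obtains c where "(\<Sum>i\<in>UNIV. mconst (c i) * mvar i) \<in> Inv {w, v}"
    "(\<Sum>i\<in>UNIV. mconst (c i) * mvar i) \<noteq> (0 :: 'n mpol)"
proof -
  have "card (UNIV :: 3 set) \<le> CARD('n)" using assms by simp
  then obtain \<iota> :: "3 \<Rightarrow> 'n" where inj: "inj \<iota>" by (meson card_le_inj finite)
  obtain g :: "complex^3" where g: "g \<noteq> 0" "(\<Sum>k\<in>UNIV. g $ k * v $ \<iota> k) = 0"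
    "(\<Sum>k\<in>UNIV. g $ k * w $ \<iota> k) = 0"
    by (rule ex_orthogonal3[of "\<lambda>k. v $ \<iota> k" "\<lambda>k. w $ \<iota> k"])
  define c where "c i = (\<Sum>k\<in>UNIV. if \<iota> k = i then g $ k else 0)" for i
  have c: "(\<Sum>i\<in>UNIV. c i * x $ i) = (\<Sum>k\<in>UNIV. g $ k * x $ \<iota> k)" for x :: "complex^'n"
  proof -
    have "(\<Sum>i\<in>UNIV. c i * x $ i) = (\<Sum>i\<in>UNIV. \<Sum>k\<in>UNIV. if \<iota> k = i then g $ k * x $ i else 0)"
      unfolding c_def sum_distrib_right by (intro sum.cong) auto
    also have "\<dots> = (\<Sum>k\<in>UNIV. \<Sum>i\<in>UNIV. if \<iota> k = i then g $ k * x $ i else 0)"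
      by (rule sum.swap)
    finally show ?thesis by simp
  qed
  let ?l = "\<Sum>i\<in>UNIV. mconst (c i) * mvar i :: 'n mpol"
  have l: "mev ?l x = (\<Sum>k\<in>UNIV. g $ k * x $ \<iota> k)" for x by (simp add: c)
  have lin: "mev ?l (x + t *s z) = mev ?l x + t * (\<Sum>k\<in>UNIV. g $ k * z $ \<iota> k)" for x z t
    unfolding l by (simp add: distrib_left sum.distrib sum_distrib_left mult.left_commute)
  have "?l \<in> Inv {w, v}"
    unfolding Inv_def
  proof (intro CollectI ballI allI)
    fix z x t assume "z \<in> {w, v}"
    then have "(\<Sum>k\<in>UNIV. g $ k * z $ \<iota> k) = 0" using g by auto
    then show "mev ?l (x + t *s z) = mev ?l x" unfolding lin by simp
  qed
  moreover have "?l \<noteq> 0"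
  proof
    assume "?l = 0"
    obtain k where k: "g $ k \<noteq> 0" using g(1) by (metis vec_eq_iff zero_index)
    have "mev ?l (axis (\<iota> k) 1) = (\<Sum>m\<in>UNIV. if m = k then g $ m else 0)"
      unfolding l by (intro sum.cong) (auto simp: axis_def inj_eq[OF inj])
    moreover have "mev ?l (axis (\<iota> k) 1) = 0" unfolding \<open>?l = 0\<close> by simp
    ultimately show False using k by simp
  qed
  ultimately show thesis by (rule that)
qed

definition zeros :: "'n::finite mpol set \<Rightarrow> (complex^'n) set" where
  "zeros P = {x. \<forall>p\<in>P. mev p x = 0}"

lemma zerosD: "x \<in> zeros P \<Longrightarrow> p \<in> P \<Longrightarrow> mev p x = 0"
  by (simp add: zeros_def)

lemma nullstellensatz_zeros:
  assumes "prime_ideal P" "\<And>x. x \<in> zeros P \<Longrightarrow> mev f x = 0"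
  shows "f \<in> P"
  using assms(1) by (rule nullstellensatz) (simp add: assms(2) zeros_def)

text \<open>Otherwise every \<open>mvar i * \<sigma>\<close> vanishes on the zeros of
  \<open>P\<close>, so all variables lie in \<open>P\<close>, against the invariant linear form. The
  origin is excluded because critical points are defined only away from it.\<close>

lemma prime_ideal_nonzero_point:
  fixes P :: "'n::finite mpol set"
  assumes P: "prime_ideal P" and card: "CARD('n) \<ge> 3" and PW: "P \<inter> Inv {w, v} \<subseteq> {0}" and s: "\<sigma> \<notin> P"
  obtains x where "x \<in> zeros P" "x \<noteq> 0" "mev \<sigma> x \<noteq> 0"
proof (rule ccontr)
  note I = prime_idealD(1)[OF P] and point = that
  assume "\<not> thesis"
  then have no: "x = 0 \<or> mev \<sigma> x = 0" if "x \<in> zeros P" for x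
    using that point[of x] by blast
  have "mvar i \<in> P" for i
  proof -
    have "mvar i * \<sigma> \<in> P"
      by (rule nullstellensatz_zeros[OF P]) (use no in force)
    then show ?thesis using prime_idealD(3)[OF P] s by blast
  qed
  then have mem: "(\<Sum>i\<in>UNIV. mconst (c i) * mvar i) \<in> P" for c
    by (intro ideal_sum[OF I] ideal_mult[OF I])
  show False
  proof (rule ex_Inv_linear[OF card, of w v])
    fix c :: "'n \<Rightarrow> complex"
    assume "(\<Sum>i\<in>UNIV. mconst (c i) * mvar i) \<in> Inv {w, v}"
      "(\<Sum>i\<in>UNIV. mconst (c i) * mvar i) \<noteq> (0 :: 'n mpol)"
    then show False using PW mem[of c] by blast
  qed
qed

lemma ex_dependent3:
  fixes d :: "3 \<Rightarrow> 'j \<Rightarrow> complex"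
  assumes "\<And>i. s i \<noteq> 0" "\<And>i j. s i * d i j = a i * A j + b i * B j"
  shows "\<exists>g :: complex^3. g \<noteq> 0 \<and> (\<forall>j. (\<Sum>i\<in>UNIV. g $ i * d i j) = 0)"
proof -
  obtain g :: "complex^3" where g: "g \<noteq> 0" "(\<Sum>i\<in>UNIV. g $ i * (a i / s i)) = 0"
    "(\<Sum>i\<in>UNIV. g $ i * (b i / s i)) = 0"
    by (rule ex_orthogonal3)
  have "d i j = a i / s i * A j + b i / s i * B j" for i j
    using assms[of i] by (simp add: field_simps)
  then have "(\<Sum>i\<in>UNIV. g $ i * d i j)
      = (\<Sum>i\<in>UNIV. g $ i * (a i / s i)) * A j + (\<Sum>i\<in>UNIV. g $ i * (b i / s i)) * B j" for j
    by (simp add: sum_distrib_left sum_distrib_right sum.distrib algebra_simps)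
  then show ?thesis using g by auto
qed

text \<open>\<sigma> is the product of the denominators in the Jacobian relations; where it is
  nonzero, three differentials lie in the span of two covectors.\<close>

lemma critical_of_rank_2:
  fixes f :: "3 \<Rightarrow> 'n::finite mpol"
  assumes P: "prime_ideal P" and rk: "jac_rank_le P UNIV 2" and f: "\<And>i. f i \<in> P"
  shows "\<exists>\<sigma>. \<sigma> \<notin> P \<and> (\<forall>x\<in>zeros P. mev \<sigma> x \<noteq> 0 \<longrightarrow>
    (\<exists>g :: complex^3. g \<noteq> 0 \<and> (\<forall>j. (\<Sum>i\<in>UNIV. g $ i * mev (mD j (f i)) x) = 0)))"
proof -
  obtain G where "\<forall>p\<in>P \<inter> UNIV. \<exists>\<sigma> c. \<sigma> \<notin> P \<and> (\<forall>j. \<sigma> * mD j p - (\<Sum>i<2::nat. c i * G i j) \<in> P)"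
    using rk unfolding jac_rank_le_def by (elim exE)
  then have "\<forall>i. \<exists>\<sigma> c. \<sigma> \<notin> P \<and> (\<forall>j. \<sigma> * mD j (f i) - (\<Sum>i<2::nat. c i * G i j) \<in> P)"
    using f by simp
  then obtain s c where s: "\<And>i. s i \<notin> P"
    and c: "\<And>i j. s i * mD j (f i) - (\<Sum>k<2::nat. c i k * G k j) \<in> P" by metis
  have "(\<Prod>i\<in>UNIV. s i) \<notin> P" using prime_ideal_prod[OF P, of UNIV s] s by auto
  moreover have "\<exists>g :: complex^3. g \<noteq> 0 \<and> (\<forall>j. (\<Sum>i\<in>UNIV. g $ i * mev (mD j (f i)) x) = 0)"
    if x: "x \<in> zeros P" "mev (\<Prod>i\<in>UNIV. s i) x \<noteq> 0" for x
  proof (rule ex_dependent3)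
    show "mev (s i) x \<noteq> 0" for i using x(2) by auto
    show "mev (s i) x * mev (mD j (f i)) x
        = mev (c i 0) x * mev (G 0 j) x + mev (c i 1) x * mev (G 1 j) x" for i j
      using zerosD[OF x(1) c[of i j]] by (simp add: numeral_2_eq_2)
  qed
  ultimately show ?thesis by blast
qed

text \<open>The differentials of the equations span at most a line modulo \<open>P\<close>. Adding
  the differential of \<open>f l\<close> gives two covectors that span all three
  differentials.\<close>

lemma critical_of_rank_1:
  fixes f :: "3 \<Rightarrow> 'n::finite mpol"
  assumes P: "prime_ideal P" and rk: "jac_rank_le P UNIV 1" and q: "q l \<noteq> 0"
    and f: "\<And>i. mconst (q l) * f i - mconst (q i) * f l \<in> P"
  shows "\<exists>\<sigma>. \<sigma> \<notin> P \<and> (\<forall>x\<in>zeros P. mev \<sigma> x \<noteq> 0 \<longrightarrow>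
    (\<exists>g :: complex^3. g \<noteq> 0 \<and> (\<forall>j. (\<Sum>i\<in>UNIV. g $ i * mev (mD j (f i)) x) = 0)))"
proof -
  let ?e = "\<lambda>i. mconst (q l) * f i - mconst (q i) * f l"
  obtain G where "\<forall>p\<in>P \<inter> UNIV. \<exists>\<sigma> c. \<sigma> \<notin> P \<and> (\<forall>j. \<sigma> * mD j p - (\<Sum>i<1::nat. c i * G i j) \<in> P)"
    using rk unfolding jac_rank_le_def by (elim exE)
  then have "\<forall>i. \<exists>\<sigma> c. \<sigma> \<notin> P \<and> (\<forall>j. \<sigma> * mD j (?e i) - (\<Sum>i<1::nat. c i * G i j) \<in> P)"
    using f by simp
  then obtain s c where s: "\<And>i. s i \<notin> P"
    and c: "\<And>i j. s i * mD j (?e i) - (\<Sum>k<1::nat. c i k * G k j) \<in> P" by metis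
  have "(\<Prod>i\<in>UNIV. s i) \<notin> P" using prime_ideal_prod[OF P, of UNIV s] s by auto
  moreover have "\<exists>g :: complex^3. g \<noteq> 0 \<and> (\<forall>j. (\<Sum>i\<in>UNIV. g $ i * mev (mD j (f i)) x) = 0)"
    if x: "x \<in> zeros P" "mev (\<Prod>i\<in>UNIV. s i) x \<noteq> 0" for x
  proof (rule ex_dependent3)
    show "mev (s i) x * q l \<noteq> 0" for i using x(2) q by auto
    show "mev (s i) x * q l * mev (mD j (f i)) x
        = mev (c i 0) x * mev (G 0 j) x + (mev (s i) x * q i) * mev (mD j (f l)) x" for i j
      using zerosD[OF x(1) c[of i j]] by (simp add: mD_diff mD_mult algebra_simps)
  qed
  ultimately show ?thesis by blast
qed

section \<open>Saturation of the ideal of maximal minors\<close>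

text \<open>The hypothesis \<open>lines\<close> bounds the codimension of the zero set of \<open>a\<close> by two from below, and \<open>\<D>\<close> that
  of the zero set of \<open>\<D>\<close> inside it by three. If some member of the regular sequence did not exist, then
  a prime ideal without nonzero invariant elements would have a point other than the origin where the
  differentials of \<open>f\<close> are dependent.\<close>

lemma mem_ideal_of_minors:
  fixes f a c :: "3 \<Rightarrow> 'n::finite mpol" and S :: "(complex^3) set"
  assumes card: "CARD('n) \<ge> 3"
    and cross: "k \<noteq> 0" "mconst k * a 1 = c 2 * f 3 - c 3 * f 2"
      "mconst k * a 2 = c 3 * f 1 - c 1 * f 3" "mconst k * a 3 = c 1 * f 2 - c 2 * f 1"
    and nz: "a m \<noteq> 0"
    and noncrit: "\<And>x g. x \<noteq> 0 \<Longrightarrow> g \<noteq> 0 \<Longrightarrow> (\<And>i. mev (a i) x = 0) \<Longrightarrow>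
      (\<And>j. (\<Sum>i\<in>UNIV. g $ i * mev (mD j (f i)) x) = 0) \<Longrightarrow> False"
    and lines: "finite S" "0 \<notin> S" "\<And>x. (\<And>i. mev (a i) x = 0) \<Longrightarrow>
      \<exists>q\<in>S. \<forall>i l. q $ l * mev (f i) x = q $ i * mev (f l) x"
    and \<D>: "\<And>x i. (\<And>i. mev (a i) x = 0) \<Longrightarrow> (\<And>d. d \<in> \<D> \<Longrightarrow> mev d x = 0) \<Longrightarrow> mev (f i) x = 0"
    and h: "\<And>d. d \<in> \<D> \<Longrightarrow> d * h \<in> ideal_of a"
  shows "h \<in> ideal_of a"
proof -
  note Ia = is_ideal_ideal_of[of a]
  let ?g1 = "a m"
  obtain v where v: "monic_along v ?g1" using ex_monic_along[OF nz] .
  have "\<not> ideal_of a \<inter> Inv {v} \<subseteq> {0}"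
  proof
    assume "ideal_of a \<inter> Inv {v} \<subseteq> {0}"
    then obtain P where P: "prime_ideal P" "ideal_of a \<subseteq> P" "P \<inter> Inv {v} \<subseteq> {0}"
      using prime_ideal_avoiding_Inv[OF Ia] by metis
    have aP: "a i \<in> P" for i using P(2) ideal_of_gen[of a i] by blast
    have "\<forall>q\<in>S. \<exists>l. q $ l \<noteq> 0" using lines(2) by (metis vec_eq_iff zero_index)
    then obtain l where l: "\<And>q. q \<in> S \<Longrightarrow> q $ l q \<noteq> 0" by metis
    let ?e = "\<lambda>q i. mconst (q $ l q) * f i - mconst (q $ i) * f (l q)"
    \<comment> \<open>Irreducibility: the zeros of \<open>P\<close> lie in the finite union of the
      loci where \<open>f\<close> is proportional to some \<open>q\<close>, hence in one of them.
      Otherwise a product of one violated equation for each \<open>q\<close> would lie in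
      \<open>P\<close>.\<close>
    have "\<exists>q\<in>S. \<forall>i. ?e q i \<in> P"
    proof (rule ccontr)
      assume "\<not> ?thesis"
      then obtain \<iota> where \<iota>: "\<And>q. q \<in> S \<Longrightarrow> ?e q (\<iota> q) \<notin> P" by metis
      have "(\<Prod>q\<in>S. ?e q (\<iota> q)) \<in> P"
      proof (rule nullstellensatz_zeros[OF P(1)])
        fix x assume "x \<in> zeros P"
        then obtain q where "q \<in> S" "\<forall>i l. q $ l * mev (f i) x = q $ i * mev (f l) x"
          using lines(3)[of x] zerosD aP by blast
        then show "mev (\<Prod>q\<in>S. ?e q (\<iota> q)) x = 0"
          using lines(1) by (auto intro!: prod_zero bexI[of _ q])
      qed
      then show False using prime_ideal_prod[OF P(1) lines(1)] \<iota> by blast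
    qed
    then obtain q where q: "q \<in> S" "\<And>i. ?e q i \<in> P" by blast
    obtain \<sigma> where \<sigma>: "\<sigma> \<notin> P" "\<And>x. x \<in> zeros P \<Longrightarrow> mev \<sigma> x \<noteq> 0 \<Longrightarrow>
        \<exists>g :: complex^3. g \<noteq> 0 \<and> (\<forall>j. (\<Sum>i\<in>UNIV. g $ i * mev (mD j (f i)) x) = 0)"
      using critical_of_rank_1[OF P(1) jac_rank_le_1[OF P(1,3)], of "\<lambda>i. q $ i" "l q" f] l q by auto
    have "P \<inter> Inv {v, v} \<subseteq> {0}" using P(3) by simp
    then obtain x where x: "x \<in> zeros P" "x \<noteq> 0" "mev \<sigma> x \<noteq> 0"
      by (rule prime_ideal_nonzero_point[OF P(1) card _ \<sigma>(1)]) (rule that)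
    obtain g :: "complex^3" where g: "g \<noteq> 0" "\<forall>j. (\<Sum>i\<in>UNIV. g $ i * mev (mD j (f i)) x) = 0"
      using \<sigma>(2)[OF x(1,3)] by blast
    show False by (rule noncrit[OF x(2) g(1) zerosD[OF x(1) aP]]) (use g(2) in blast)
  qed
  then obtain g2 where g2: "g2 \<in> ideal_of a" "g2 \<in> Inv {v}" "g2 \<noteq> 0" by blast
  obtain w where w: "monic_along w g2" using ex_monic_along[OF g2(3)] .
  let ?D = "{d. d * h \<in> ideal_of a}"
  have ID: "is_ideal ?D"
    unfolding is_ideal_def
    using ideal_zero[OF Ia] ideal_add[OF Ia] ideal_mult[OF Ia] by (auto simp: distrib_right mult.assoc)
  have "\<not> ?D \<inter> Inv {w, v} \<subseteq> {0}"
  proof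
    assume "?D \<inter> Inv {w, v} \<subseteq> {0}"
    then obtain P where P: "prime_ideal P" "?D \<subseteq> P" "P \<inter> Inv {w, v} \<subseteq> {0}"
      using prime_ideal_avoiding_Inv[OF ID] by metis
    have aP: "a i \<in> P" for i
      using P(2) ideal_mult_right[OF Ia ideal_of_gen[of a i], of h] by blast
    have DP: "d \<in> P" if "d \<in> \<D>" for d using P(2) h[OF that] by blast
    have fP: "f i \<in> P" for i
    proof (rule nullstellensatz_zeros[OF P(1)])
      fix x assume x: "x \<in> zeros P"
      show "mev (f i) x = 0" by (rule \<D>[OF zerosD[OF x aP] zerosD[OF x DP]])
    qed
    obtain \<sigma> where \<sigma>: "\<sigma> \<notin> P" "\<And>x. x \<in> zeros P \<Longrightarrow> mev \<sigma> x \<noteq> 0 \<Longrightarrow>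
        \<exists>g :: complex^3. g \<noteq> 0 \<and> (\<forall>j. (\<Sum>i\<in>UNIV. g $ i * mev (mD j (f i)) x) = 0)"
      using critical_of_rank_2[of P f, OF P(1) jac_rank_le_2[OF P(1,3)] fP] by blast
    obtain x where x: "x \<in> zeros P" "x \<noteq> 0" "mev \<sigma> x \<noteq> 0"
      by (rule prime_ideal_nonzero_point[OF P(1) card P(3) \<sigma>(1)]) (rule that)
    obtain g :: "complex^3" where g: "g \<noteq> 0" "\<forall>j. (\<Sum>i\<in>UNIV. g $ i * mev (mD j (f i)) x) = 0"
      using \<sigma>(2)[OF x(1,3)] by blast
    show False by (rule noncrit[OF x(2) g(1) zerosD[OF x(1) aP]]) (use g(2) in blast)
  qed
  then obtain g3 where g3: "g3 * h \<in> ideal_of a" "g3 \<in> Inv {w, v}" "g3 \<noteq> 0" by blast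
  from g3(2) have g3': "g3 \<in> Inv {v}" "g3 \<in> Inv {w}" by (simp_all add: Inv_def)
  let ?b1 = "c 2 * f 3 - c 3 * f 2" and ?b2 = "c 3 * f 1 - c 1 * f 3" and ?b3 = "c 1 * f 2 - c 2 * f 1"
  have to_b: "\<exists>p1 p2 p3. q = ?b1 * p1 + ?b2 * p2 + ?b3 * p3" if q: "q \<in> ideal_of a" for q
  proof -
    obtain p :: "3 \<Rightarrow> 'n mpol" where "q = p 1 * a 1 + p 2 * a 2 + p 3 * a 3"
      using q by (auto simp: ideal_of_def sum_3)
    also have "\<dots> = (mconst (inverse k) * mconst k) * (p 1 * a 1 + p 2 * a 2 + p 3 * a 3)"
      by (simp add: mconst_unit[OF cross(1)])
    also have "\<dots> = (mconst k * a 1) * (mconst (inverse k) * p 1)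
        + (mconst k * a 2) * (mconst (inverse k) * p 2) + (mconst k * a 3) * (mconst (inverse k) * p 3)"
      by (simp add: algebra_simps)
    finally show ?thesis
      unfolding cross(2-4) by (intro exI[of _ "mconst (inverse k) * p i" for i])
  qed
  obtain p1 p2 p3 where p: "?g1 = ?b1 * p1 + ?b2 * p2 + ?b3 * p3" using to_b[OF ideal_of_gen] by blast
  obtain q1 q2 q3 where q: "g2 = ?b1 * q1 + ?b2 * q2 + ?b3 * q3" using to_b[OF g2(1)] by blast
  obtain u1 u2 u3 where u: "g3 * h = ?b1 * u1 + ?b2 * u2 + ?b3 * u3" using to_b[OF g3(1)] by blast
  obtain t1 t2 t3 where "h = ?b1 * t1 + ?b2 * t2 + ?b3 * t3"
  proof (rule cross_nonzerodivisor[OF p q nz g2(3) g3(3) _ _ _ _ u])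
    show "g2 dvd X" if "?g1 * X = g2 * b" for X b
      using monic_along_regular1[OF v g2(2) that] .
    show "g3 dvd X" if "?g1 * X = g3 * b" for X b
      using monic_along_regular1[OF v g3'(1) that] .
    show "g3 dvd X" if "g2 * X = g3 * b" for X b
      using monic_along_regular1[OF w g3'(2) that] .
    show "\<exists>y z. X = g2 * y + g3 * z" if "?g1 * X = g2 * b + g3 * d" for X b d
      using monic_along_regular2[OF v g2(2) g3'(1) that] .
  qed blast
  also have "\<dots> = mconst k * t1 * a 1 + mconst k * t2 * a 2 + mconst k * t3 * a 3"
    unfolding cross(2-4)[symmetric] by (simp add: mult_ac)
  also have "\<dots> \<in> ideal_of a"
    by (intro ideal_add[OF Ia] ideal_mult[OF Ia] ideal_of_gen)
  finally show ?thesis .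
qed

section \<open>The ideals of a pullback form\<close>

definition mdform :: "('n \<Rightarrow> 'n::finite mpol) \<Rightarrow> 'n \<Rightarrow> 'n \<Rightarrow> 'n mpol" where
  "mdform w i j = mD i (w j) - mD j (w i)"

lemma dform_mev: "dform (\<lambda>i. mev (w i)) i j = mev (mdform w i j)"
  by (rule ext) (simp add: dform_def mdform_def mev_mD)

lemma Iid_mev:
  "Iid (\<lambda>i. mev (w i)) = mev ` {h. \<exists>\<eta>. \<forall>i j. h * mdform w i j = w i * \<eta> j - w j * \<eta> i}"
    (is "_ = mev ` ?R")
proof (intro equalityI subsetI)
  fix h assume "h \<in> Iid (\<lambda>i. mev (w i))"
  then obtain \<eta> where h: "polyfun h" and \<eta>: "\<And>i. polyfun (\<eta> i)"
    and e: "\<And>i j. (\<lambda>x. h x * dform (\<lambda>i. mev (w i)) i j x) = wedge11 (\<lambda>i. mev (w i)) \<eta> i j"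
    unfolding Iid_def by blast
  have "Mpol h * mdform w i j = w i * Mpol (\<eta> j) - w j * Mpol (\<eta> i)" for i j
  proof (rule mpol_eqI)
    fix x
    show "mev (Mpol h * mdform w i j) x = mev (w i * Mpol (\<eta> j) - w j * Mpol (\<eta> i)) x"
      using fun_cong[OF e[of i j], of x] by (simp add: mev_Mpol h \<eta> dform_mev wedge11_def)
  qed
  then have "Mpol h \<in> ?R" by (intro CollectI exI[of _ "\<lambda>i. Mpol (\<eta> i)"]) simp
  with mev_Mpol[OF h, symmetric] show "h \<in> mev ` ?R" by (rule image_eqI)
next
  fix h assume "h \<in> mev ` ?R"
  then obtain p \<eta> where h: "h = mev p" and e: "\<And>i j. p * mdform w i j = w i * \<eta> j - w j * \<eta> i"
    by blast
  have "(\<lambda>x. h x * dform (\<lambda>i. mev (w i)) i j x) = wedge11 (\<lambda>i. mev (w i)) (\<lambda>i. mev (\<eta> i)) i j" for i j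
  proof
    fix x
    show "h x * dform (\<lambda>i. mev (w i)) i j x = wedge11 (\<lambda>i. mev (w i)) (\<lambda>i. mev (\<eta> i)) i j x"
      using arg_cong[OF e[of i j], of "\<lambda>p. mev p x"] by (simp add: h dform_mev wedge11_def)
  qed
  then show "h \<in> Iid (\<lambda>i. mev (w i))"
    unfolding Iid_def using h polyfun_mev
    by (intro CollectI conjI exI[of _ "\<lambda>i. mev (\<eta> i)"]) auto
qed

lemma Kid_mev:
  "Kid (\<lambda>i. mev (w i)) = mev ` {h. \<forall>i j. h * mdform w i j \<in> ideal_of w}" (is "_ = mev ` ?R")
proof -
  let ?d = "\<lambda>p. mdform w (fst p) (snd p)"
  have "{dform (\<lambda>i. mev (w i)) i j | i j. True} = range (\<lambda>p. mev (?d p))"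
    by (auto simp: dform_mev image_def)
  then have G: "gen_ideal {dform (\<lambda>i. mev (w i)) i j | i j. True} = mev ` ideal_of ?d"
    by (simp only: gen_ideal_range)
  have m: "(\<lambda>x. mev h x * mev g x) \<in> mev ` J \<longleftrightarrow> h * g \<in> J" for h g :: "'a mpol" and J
  proof -
    have e: "(\<lambda>x. mev h x * mev g x) = mev (h * g)" by auto
    show ?thesis unfolding e by (auto simp: mev_inject)
  qed
  have K: "mev h \<in> Kid (\<lambda>i. mev (w i)) \<longleftrightarrow> (\<forall>g\<in>ideal_of ?d. h * g \<in> ideal_of w)" for h
    unfolding Kid_def G Jid_def gen_ideal_range
    by (simp only: mem_Collect_eq polyfun_mev simp_thms ball_simps m)
  also have "\<dots> h \<longleftrightarrow> h \<in> ?R" for h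
  proof
    assume "\<forall>g\<in>ideal_of ?d. h * g \<in> ideal_of w"
    then show "h \<in> ?R" using ideal_of_gen[of ?d] by force
  next
    assume h: "h \<in> ?R"
    have "is_ideal {g. h * g \<in> ideal_of w}"
      unfolding is_ideal_def
      using ideal_zero[OF is_ideal_ideal_of[of w]] ideal_add[OF is_ideal_ideal_of[of w]]
        ideal_mult[OF is_ideal_ideal_of[of w]]
      by (auto simp: distrib_left mult.left_commute)
    then have "ideal_of ?d \<subseteq> {g. h * g \<in> ideal_of w}"
      by (rule ideal_of_least) (use h in simp)
    then show "\<forall>g\<in>ideal_of ?d. h * g \<in> ideal_of w" by blast
  qed
  finally have K: "mev h \<in> Kid (\<lambda>i. mev (w i)) \<longleftrightarrow> h \<in> ?R" for h .
  have "\<exists>p. h = mev p" if "h \<in> Kid (\<lambda>i. mev (w i))" for h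
  proof -
    have "polyfun h" using that unfolding Kid_def by blast
    then show ?thesis using mev_Mpol[symmetric] by blast
  qed
  then show ?thesis using K by blast
qed

section \<open>Pullback of forms\<close>

definition mpullback :: "('m::finite \<Rightarrow> 'n::finite mpol) \<Rightarrow> ('m \<Rightarrow> 'm mpol) \<Rightarrow> 'n \<Rightarrow> 'n mpol" where
  "mpullback f A j = (\<Sum>i\<in>UNIV. mcomp (A i) f * mD j (f i))"

text \<open>Exterior derivative commutes with pullback: the second derivatives of \<open>f\<close>
  cancel by symmetry.\<close>

lemma mdform_mpullback:
  "mdform (mpullback f A) j k
    = (\<Sum>l\<in>UNIV. \<Sum>i\<in>UNIV. mcomp (mdform A l i) f * mD j (f l) * mD k (f i))"
proof -
  have D: "mD j (mpullback f A k) = (\<Sum>l\<in>UNIV. \<Sum>i\<in>UNIV. mcomp (mD l (A i)) f * mD j (f l) * mD k (f i))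
      + (\<Sum>i\<in>UNIV. mcomp (A i) f * mD j (mD k (f i)))" for j k
    unfolding mpullback_def mD_sum mD_mult mD_mcomp sum.distrib sum_distrib_right
    by (subst sum.swap) simp
  have "(\<Sum>l\<in>UNIV. \<Sum>i\<in>UNIV. mcomp (mD l (A i)) f * mD k (f l) * mD j (f i))
      = (\<Sum>l\<in>UNIV. \<Sum>i\<in>UNIV. mcomp (mD i (A l)) f * mD j (f l) * mD k (f i))"
    by (subst sum.swap) (simp add: mult_ac)
  then have "mdform (mpullback f A) j k
      = (\<Sum>l\<in>UNIV. \<Sum>i\<in>UNIV. mcomp (mD l (A i)) f * mD j (f l) * mD k (f i))
      - (\<Sum>l\<in>UNIV. \<Sum>i\<in>UNIV. mcomp (mD i (A l)) f * mD j (f l) * mD k (f i))"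
    unfolding mdform_def D by (simp add: mD_commute[of j k])
  then show ?thesis
    by (simp add: sum_subtractf[symmetric] mdform_def mcomp_simps algebra_simps)
qed

text \<open>Contracting \<open>\<omega> \<and> d\<omega> = 0\<close> with a coordinate vector field gives \<open>A m d\<omega> = \<omega> \<and> \<eta>\<close>, an identity that
  pulls back.\<close>

lemma mpullback_coeff_division:
  assumes "\<And>i j k. A i * mdform A j k - A j * mdform A i k + A k * mdform A i j = 0"
  shows "\<exists>\<eta>. \<forall>j k. mcomp (A m) f * mdform (mpullback f A) j k
    = mpullback f A j * \<eta> k - mpullback f A k * \<eta> j"
proof (intro exI allI)
  fix j k
  let ?\<eta> = "\<lambda>k. \<Sum>i\<in>UNIV. mcomp (mdform A m i) f * mD k (f i)"
  have e: "mcomp (A m) f * mcomp (mdform A l i) f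
      = mcomp (A l) f * mcomp (mdform A m i) f - mcomp (A i) f * mcomp (mdform A m l) f" for l i
  proof -
    have "A m * mdform A l i = A l * mdform A m i - A i * mdform A m l"
      using assms[of m l i] by (simp add: algebra_simps)
    from arg_cong[OF this, of "\<lambda>p. mcomp p f"] show ?thesis by (simp add: mcomp_simps)
  qed
  have "mcomp (A m) f * mdform (mpullback f A) j k
      = (\<Sum>l\<in>UNIV. \<Sum>i\<in>UNIV. (mcomp (A m) f * mcomp (mdform A l i) f) * mD j (f l) * mD k (f i))"
    unfolding mdform_mpullback sum_distrib_left by (simp add: mult.assoc)
  also have "\<dots> = (\<Sum>l\<in>UNIV. \<Sum>i\<in>UNIV. (mcomp (A l) f * mD j (f l)) * (mcomp (mdform A m i) f * mD k (f i)))
      - (\<Sum>l\<in>UNIV. \<Sum>i\<in>UNIV. (mcomp (mdform A m l) f * mD j (f l)) * (mcomp (A i) f * mD k (f i)))"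
    unfolding e sum_subtractf[symmetric] by (simp add: algebra_simps)
  also have "\<dots> = mpullback f A j * ?\<eta> k - mpullback f A k * ?\<eta> j"
    unfolding mpullback_def sum_product[symmetric] by (simp add: mult.commute)
  finally show "mcomp (A m) f * mdform (mpullback f A) j k
      = mpullback f A j * ?\<eta> k - mpullback f A k * ?\<eta> j" .
qed

text \<open>By Cartan's formula the contraction of \<open>d\<omega>\<close> with the radial field is the Lie derivative \<open>e \<omega>\<close>.\<close>

lemma radial_contraction:
  assumes hom: "\<And>i t x. mev (A i) (t *s x) = t ^ d * mev (A i) x"
    and rad: "\<And>x. (\<Sum>i\<in>UNIV. x $ i * mev (A i) x) = 0"
  shows "(\<Sum>i\<in>UNIV. mvar i * mdform A i k) = mconst (of_nat (Suc d)) * A k"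
proof -
  have "(\<Sum>i\<in>UNIV. mvar i * A i) = 0" by (rule mpol_eqI) (simp add: rad)
  then have "mD k (\<Sum>i\<in>UNIV. mvar i * A i) = 0" by simp
  moreover have "mD k (\<Sum>i\<in>UNIV. mvar i * A i)
      = (\<Sum>i\<in>UNIV. if i = k then A i else 0) + (\<Sum>i\<in>UNIV. mvar i * mD k (A i))"
    unfolding mD_sum mD_mult sum.distrib[symmetric] mD_var by (intro sum.cong) auto
  ultimately have 1: "(\<Sum>i\<in>UNIV. mvar i * mD k (A i)) = - A k"
    by (simp add: add_eq_0_iff)
  have 2: "(\<Sum>i\<in>UNIV. mvar i * mD i (A k)) = mconst (of_nat d) * A k"
    by (rule mpol_eqI) (simp add: euler_identity[OF hom])
  have "(\<Sum>i\<in>UNIV. mvar i * mdform A i k) = mconst (of_nat d) * A k + A k"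
    unfolding mdform_def right_diff_distrib sum_subtractf 1 2 by simp
  also have "\<dots> = mconst (of_nat (Suc d)) * A k" by (simp add: mconst_add distrib_right)
  finally show ?thesis .
qed

theorem theorem5p1:
  fixes A :: "3 \<Rightarrow> complex^3 \<Rightarrow> complex"
    and F :: "3 \<Rightarrow> complex^'n::finite \<Rightarrow> complex"
    and e \<nu> :: nat
  assumes "CARD('n) \<ge> 3"
    and "foliation_P2 e A"
    and "\<forall>i. homog (F i) \<nu>"
    and "dominant F"
    and "generic_pair F A"
  shows "Iid (pullback F A) = Kid (pullback F A) \<and>
         Kid (pullback F A) = gen_ideal (range (\<lambda>i x. A i (Fvec F x)))"
proof -
  have pA: "polyfun (A i)" and pF: "polyfun (F i)" for i
    using assms(2,3) by (auto simp: foliation_P2_def homog_def)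
  define B where "B i = Mpol (A i)" for i
  define f where "f i = Mpol (F i)" for i
  have mB [simp]: "mev (B i) = A i" and mf [simp]: "mev (f i) = F i" for i
    by (simp_all add: B_def f_def mev_Mpol pA pF)
  define a where "a i = mcomp (B i) f" for i
  have ma: "mev (a i) x = A i (Fvec F x)" for i x by (simp add: a_def Fvec_def)
  let ?w = "mpullback f B"
  have w: "pullback F A = (\<lambda>j. mev (?w j))"
    by (intro ext) (simp add: pullback_def mpullback_def mev_mD Fvec_def)
  have dA: "dform A = (\<lambda>i j. mev (mdform B i j))"
    using dform_mev[of B] by (intro ext) simp
  have E: "gen_ideal (range (\<lambda>i x. A i (Fvec F x))) = mev ` ideal_of a"
  proof -
    have "(\<lambda>i x. A i (Fvec F x)) = (\<lambda>i. mev (a i))" by (intro ext) (simp add: ma)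
    then show ?thesis by (simp only: gen_ideal_range)
  qed

  let ?I = "{h. \<exists>\<eta>. \<forall>i j. h * mdform ?w i j = ?w i * \<eta> j - ?w j * \<eta> i}"
  let ?K = "{h. \<forall>i j. h * mdform ?w i j \<in> ideal_of ?w}"
  have w_a: "?w j \<in> ideal_of a" for j
    using ideal_ofI[of "\<lambda>i. mD j (f i)" a] by (simp add: mpullback_def a_def mult.commute)

  have "is_ideal ?I"
    unfolding is_ideal_def
  proof (intro conjI ballI allI)
    show "0 \<in> ?I" by (intro CollectI exI[of _ "\<lambda>_. 0"]) simp
  next
    fix g h assume "g \<in> ?I" "h \<in> ?I"
    then obtain \<eta> \<theta> where "\<And>i j. g * mdform ?w i j = ?w i * \<eta> j - ?w j * \<eta> i"
      "\<And>i j. h * mdform ?w i j = ?w i * \<theta> j - ?w j * \<theta> i" by blast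
    then show "g + h \<in> ?I"
      by (intro CollectI exI[of _ "\<lambda>i. \<eta> i + \<theta> i"]) (simp add: algebra_simps)
  next
    fix r h assume "h \<in> ?I"
    then obtain \<eta> where \<eta>: "\<And>i j. h * mdform ?w i j = ?w i * \<eta> j - ?w j * \<eta> i" by blast
    have "r * h * mdform ?w i j = ?w i * (r * \<eta> j) - ?w j * (r * \<eta> i)" for i j
      unfolding mult.assoc \<eta> by (simp add: algebra_simps)
    then show "r * h \<in> ?I" by (intro CollectI exI[of _ "\<lambda>i. r * \<eta> i"]) blast
  qed
  moreover have "a m \<in> ?I" for m
  proof -
    have "B i * mdform B j k - B j * mdform B i k + B k * mdform B i j = 0" for i j k
    proof (rule mpol_eqI)
      fix x
      have "(\<lambda>x. A i x * dform A j k x - A j x * dform A i k x + A k x * dform A i j x) = (\<lambda>x. 0)"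
        using assms(2) by (simp add: foliation_P2_def Defs.integrable_def)
      from fun_cong[OF this, of x]
      show "mev (B i * mdform B j k - B j * mdform B i k + B k * mdform B i j) x = mev 0 x"
        by (simp add: dA)
    qed
    then show ?thesis unfolding a_def by (intro CollectI mpullback_coeff_division)
  qed
  ultimately have aI: "ideal_of a \<subseteq> ?I" by (rule ideal_of_least)

  have IK: "?I \<subseteq> ?K"
  proof
    fix h assume "h \<in> ?I"
    then obtain \<eta> where \<eta>: "\<And>i j. h * mdform ?w i j = ?w i * \<eta> j - ?w j * \<eta> i" by blast
    have "h * mdform ?w i j \<in> ideal_of ?w" for i j
      unfolding \<eta> by (intro ideal_diff[OF is_ideal_ideal_of]
          ideal_mult_right[OF is_ideal_ideal_of] ideal_of_gen)
    then show "h \<in> ?K" by blast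
  qed

  obtain S0 where S0: "finite S0" "\<And>p. p \<in> sing_pts A \<Longrightarrow> \<exists>q\<in>S0. \<exists>c. p = c *s q"
    using assms(2) unfolding foliation_P2_def by blast
  have sing: "Fvec F x \<in> sing_pts A" if "\<And>i. mev (a i) x = 0" "Fvec F x \<noteq> 0" for x
    using that by (simp add: sing_pts_def ma)
  \<comment> \<open>A common zero of the A_i(F) is either a base point, which is never critical, or
    is mapped into the singular set, which the critical values avoid.\<close>
  have noncrit: False if x: "x \<noteq> 0" "g \<noteq> 0" "\<And>i. mev (a i) x = 0"
    "\<And>j. (\<Sum>i\<in>UNIV. g $ i * mev (mD j (f i)) x) = 0" for x g
  proof -
    have "critical_pt F x" unfolding critical_pt_def using x by (auto simp: mev_mD)
    moreover from this have "Fvec F x \<noteq> 0" using assms(5) by (simp add: generic_pair_def)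
    ultimately show False using assms(5) sing[OF x(3)] by (auto simp: generic_pair_def)
  qed
  obtain i0 where i0: "A i0 \<noteq> (\<lambda>x. 0)" using assms(2) by (auto simp: foliation_P2_def)
  have nz: "a i0 \<noteq> 0"
  proof
    assume "a i0 = 0"
    then have "A i0 (Fvec F x) = 0" for x using ma[of i0 x] by simp
    then show False using assms(4) pA i0 unfolding dominant_def by blast
  qed
  \<comment> \<open>Dominance excludes \<nu> = 0, tested on y_1 minus a constant. Hence a point with
    nonzero F-value is not the origin, as criticality demands.\<close>
  have F0: "F i 0 = 0" for i
  proof -
    have hom: "F i (t *s x) = t ^ \<nu> * F i x" for i t x using assms(3) by (simp add: homog_def)
    have "\<nu> \<noteq> 0"
    proof
      assume "\<nu> = 0"
      then have "F 1 x = F 1 0" for x using hom[of 1 0 x] by simp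
      then have "\<forall>x. Fvec F x $ 1 - F 1 0 = 0" by (simp add: Fvec_def)
      moreover have "polyfun (\<lambda>y :: complex^3. y $ 1 - F 1 0)"
        by (intro polyfun_diff pvar pconst)
      ultimately have "(\<lambda>y :: complex^3. y $ 1 - F 1 0) = (\<lambda>y. 0)"
        using assms(4) unfolding dominant_def by blast
      from fun_cong[OF this, of "\<chi> i. F 1 0 + 1"] show False by simp
    qed
    then show ?thesis using hom[of i 0 0] by (simp add: power_0_left)
  qed

  \<comment> \<open>Directions of lines must be nonzero, hence the removal of 0. The vector 1 keeps
    \<open>S\<close> nonempty for points with F(x) = 0, where every \<open>q\<close> satisfies the
    equations.\<close>
  define S where "S = insert 1 (S0 - {0})"
  define c where "c i = mcomp (if i = 1 then mdform B 2 3 else if i = 2 then mdform B 3 1 else mdform B 1 2) f"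
    for i :: 3
  have KE: "h \<in> ideal_of a" if h: "h \<in> ?K" for h
  proof (rule mem_ideal_of_minors[where a = a and f = f and c = c and m = i0 and S = S
        and k = "of_nat e" and \<D> = "{mdform ?w i j | i j. True}"])
    show "(of_nat e :: complex) \<noteq> 0" using assms(2) by (simp add: foliation_P2_def)
    have "Suc (e - 1) = e" using assms(2) by (simp add: foliation_P2_def)
    then have "(\<Sum>i\<in>UNIV. mvar i * mdform B i k) = mconst (of_nat e) * B k" for k
      using radial_contraction[of B "e - 1" k] assms(2) by (simp add: foliation_P2_def homog_def)
    then have "mcomp (\<Sum>i\<in>UNIV. mvar i * mdform B i k) f = mcomp (mconst (of_nat e) * B k) f" for k
      by simp
    then have r: "mconst (of_nat e) * a k = f 1 * mcomp (mdform B 1 k) f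
        + f 2 * mcomp (mdform B 2 k) f + f 3 * mcomp (mdform B 3 k) f" for k
      by (simp add: a_def mcomp_simps sum_3)
    show "mconst (of_nat e) * a 1 = c 2 * f 3 - c 3 * f 2"
      "mconst (of_nat e) * a 2 = c 3 * f 1 - c 1 * f 3"
      "mconst (of_nat e) * a 3 = c 1 * f 2 - c 2 * f 1"
      unfolding r c_def by (simp_all add: mdform_def mcomp_simps algebra_simps)
    show "finite S" "0 \<notin> S" using S0(1) by (auto simp: S_def)
    show "\<exists>q\<in>S. \<forall>i l. q $ l * mev (f i) x = q $ i * mev (f l) x" if x: "\<And>i. mev (a i) x = 0" for x
    proof (cases "Fvec F x = 0")
      case True
      then have "F i x = 0" for i by (simp add: Fvec_def vec_eq_iff)
      then show ?thesis by (auto simp: S_def)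
    next
      case False
      then obtain q b where q: "q \<in> S0" "Fvec F x = b *s q" using S0(2)[OF sing[OF x]] by blast
      then have "F i x = b * q $ i" for i by (simp add: Fvec_def vec_eq_iff)
      moreover have "q \<in> S" using q False by (auto simp: S_def)
      ultimately show ?thesis by (auto intro!: bexI[of _ q])
    qed
    show "mev (f i) x = 0" if x: "\<And>i. mev (a i) x = 0"
      "\<And>d. d \<in> {mdform ?w i j | i j. True} \<Longrightarrow> mev d x = 0" for i x
    proof (rule ccontr)
      assume "mev (f i) x \<noteq> 0"
      then have F: "Fvec F x \<noteq> 0" by (auto simp: Fvec_def vec_eq_iff)
      have x0: "x \<noteq> 0" using \<open>mev (f i) x \<noteq> 0\<close> F0 by auto
      let ?d = "\<lambda>l i. mev (mcomp (mdform B l i) f) x"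
      have d: "?d l i = dform A l i (Fvec F x)" for l i by (simp add: dA Fvec_def)
      obtain l0 i0 where nz: "?d l0 i0 \<noteq> 0"
        using assms(5) sing[OF x(1) F] unfolding generic_pair_def kupka_pt_def d by blast
      \<comment> \<open>Independence of the dF_i at \<open>x\<close> is used twice, once for each
        Jacobian factor of the pulled-back 2-form. What remains is that d omega vanishes at F(x),
        against the Kupka condition.\<close>
      have "(\<Sum>l\<in>UNIV. ?d l i * mev (mD j (f l)) x) = 0" for i j
      proof (rule ccontr)
        let ?g = "\<chi> i. \<Sum>l\<in>UNIV. ?d l i * mev (mD j (f l)) x"
        assume "(\<Sum>l\<in>UNIV. ?d l i * mev (mD j (f l)) x) \<noteq> 0"
        then have "?g \<noteq> 0" by (auto simp: vec_eq_iff)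
        moreover have "(\<Sum>i\<in>UNIV. ?g $ i * mev (mD k (f i)) x) = 0" for k
        proof -
          have "mev (mdform ?w j k) x = 0" using x(2) by blast
          then have "(\<Sum>l\<in>UNIV. \<Sum>i\<in>UNIV. ?d l i * mev (mD j (f l)) x * mev (mD k (f i)) x) = 0"
            by (simp add: mdform_mpullback del: mev_mcomp)
          then show ?thesis by (subst (asm) sum.swap) (simp add: sum_distrib_right del: mev_mcomp)
        qed
        ultimately show False using noncrit[OF x0 _ x(1)] by blast
      qed
      then have "(\<Sum>l\<in>UNIV. (\<chi> l. ?d l i0) $ l * mev (mD j (f l)) x) = 0" for j by simp
      moreover have "(\<chi> l. ?d l i0) \<noteq> 0" using nz by (auto simp: vec_eq_iff)
      ultimately show False using noncrit[OF x0 _ x(1)] by blast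
    qed
    show "d * h \<in> ideal_of a" if d: "d \<in> {mdform ?w i j | i j. True}" for d
    proof -
      have "ideal_of ?w \<subseteq> ideal_of a" by (rule ideal_of_least[OF is_ideal_ideal_of w_a])
      then show ?thesis using h d by (auto simp: mult.commute)
    qed
  qed (use assms(1) nz noncrit in auto)

  have "?I = ?K" "?K = ideal_of a" using aI IK KE by blast+
  then show ?thesis unfolding w Iid_mev Kid_mev E by simp
qed

end
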